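(* Let $\mathcal{H}$ be a separable Hilbert space and let $\Psi=(\psi_\eta)_{\eta\in\mathbb{R}^2}\subset\mathcal{H}$ be a continuous Parseval frame on $\mathbb{R}^2$ with Lebesgue measure ($\eta\mapsto\psi_\eta$ weakly measurable and $\|f\|^2=\int_{\mathbb{R}^2}|\langle f,\psi_\eta\rangle|^2d\eta$ for all $f\in\mathcal{H}$). Let $R(\nu,\eta)=\langle\psi_\eta,\psi_\nu\rangle$ and $K^{(\eta,\nu)}(\rho)=R(\eta,\rho)R(\rho,\nu)$ for $\eta,\nu,\rho\in\mathbb{R}^2$, and assume that $K^{(\eta,\nu)}$ has continuous mixed partial derivatives $\partial_1K^{(\eta,\nu)},\partial_2K^{(\eta,\nu)},\partial_{12}K^{(\eta,\nu)}$ for almost all $\eta,\nu\in\mathbb{R}^2$. Define $$\Omega(\Psi)=\operatorname*{ess\,sup}_{\nu\in\mathbb{R}^2}\int_{\mathbb{R}^2}\Bigl[\|\partial_1K^{(\eta,\nu)}\|_{L^1}+\|\partial_2K^{(\eta,\nu)}\|_{L^1}+\|\partial_{12}K^{(\eta,\nu)}\|_{L^1}\Bigr]d\eta,$$ with $L^1$-norms over $\mathbb{R}^2$. Let $\Lambda\subset\mathbb{R}^2$ be a discrete set with $N_\rho:=\#(\Lambda\cap([0,1]^2+\rho))\ge1$ for all $\rho\in\mathbb{R}^2$, let $a_\lambda=\int_{\mathbb{R}^2}\chi_{[0,1]^2+\rho}(\lambda)/N_\rho\,d\rho$ for $\lambda\in\Lambda$, and let $$\mathcal{D}^*_{\mathrm{shift}}(\Lambda)=\sup_{\rho\in\mathbb{R}^2}\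 \sup_{\eta\in[0,1]^2}\left|\frac{\#(\Lambda\cap(\rho+[0,\eta]))}{N_\rho}-\mu([0,\eta])\right|.$$ If $\mathcal{D}^*_{\mathrm{shift}}(\Lambda)\,\Omega(\Psi)<1$, then $(\sqrt{a_\lambda}\,\psi_\lambda)_{\lambda\in\Lambda}$ is a discrete frame for $\mathcal{H}$ with frame bounds $1-\mathcal{D}^*_{\mathrm{shift}}(\Lambda)\Omega(\Psi)$ and $1+\mathcal{D}^*_{\mathrm{shift}}(\Lambda)\Omega(\Psi)$.
   Context: $\mu$ is Lebesgue measure, $\chi_M$ the characteristic function of $M$, $[0,\eta]=[0,\eta_1]\times[0,\eta_2]$. A family $(\phi_\lambda)$ is a frame with bounds $A,B$ if $A\|f\|^2\le\sum_\lambda|\langle f,\phi_\lambda\rangle|^2\le B\|f\|^2$ for all $f\in\mathcal{H}$. *)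

theory Defs
  imports "HOL-Analysis.Analysis"
begin

class complex_hilbert = banach +
  fixes hscaleC :: "complex \<Rightarrow> 'a \<Rightarrow> 'a"
    and hinner :: "'a \<Rightarrow> 'a \<Rightarrow> complex"
  assumes hscaleC_of_real: "hscaleC (complex_of_real r) x = scaleR r x"
    and hscaleC_add_right: "hscaleC c (x + y) = hscaleC c x + hscaleC c y"
    and hscaleC_add_left: "hscaleC (c + d) x = hscaleC c x + hscaleC d x"
    and hscaleC_assoc: "hscaleC c (hscaleC d x) = hscaleC (c * d) x"
    and hinner_conj: "hinner y x = cnj (hinner x y)"
    and hinner_add_left: "hinner (x + y) z = hinner x z + hinner y z"
    and hinner_scaleC_left: "hinner (hscaleC c x) y = c * hinner x y"
    and hinner_norm: "hinner x x = complex_of_real ((norm x)\<^sup>2)"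

definition separable_space :: "'a::metric_space itself \<Rightarrow> bool" where
  "separable_space _ \<longleftrightarrow> (\<exists>D::'a set. countable D \<and> closure D = UNIV)"

definition partial1 :: "(real \<times> real \<Rightarrow> complex) \<Rightarrow> real \<times> real \<Rightarrow> complex" where
  "partial1 K p = vector_derivative (\<lambda>s. K (s, snd p)) (at (fst p))"

definition partial2 :: "(real \<times> real \<Rightarrow> complex) \<Rightarrow> real \<times> real \<Rightarrow> complex" where
  "partial2 K p = vector_derivative (\<lambda>t. K (fst p, t)) (at (snd p))"

definition partial12 :: "(real \<times> real \<Rightarrow> complex) \<Rightarrow> real \<times> real \<Rightarrow> complex" where
  "partial12 K = partial2 (partial1 K)"

definition has_cont_mixed_partials :: "(real \<times> real \<Rightarrow> complex) \<Rightarrow> bool" where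
  "has_cont_mixed_partials K \<longleftrightarrow>
     (\<exists>D1 D2 D12.
        continuous_on UNIV D1 \<and> continuous_on UNIV D2 \<and> continuous_on UNIV D12 \<and>
        (\<forall>x y. ((\<lambda>s. K (s, y)) has_vector_derivative D1 (x, y)) (at x)) \<and>
        (\<forall>x y. ((\<lambda>t. K (x, t)) has_vector_derivative D2 (x, y)) (at y)) \<and>
        (\<forall>x y. ((\<lambda>t. D1 (x, t)) has_vector_derivative D12 (x, y)) (at y)))"

definition L1norm :: "(real \<times> real \<Rightarrow> complex) \<Rightarrow> ennreal" where
  "L1norm g = (\<integral>\<^sup>+ p. ennreal (norm (g p)) \<partial>lborel)"

definition ess_sup :: "'a measure \<Rightarrow> ('a \<Rightarrow> ennreal) \<Rightarrow> ennreal" where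
  "ess_sup M g = Inf {c. AE x in M. g x \<le> c}"

definition frame_R :: "(real \<times> real \<Rightarrow> 'a::complex_hilbert) \<Rightarrow> real \<times> real \<Rightarrow> real \<times> real \<Rightarrow> complex" where
  "frame_R \<psi> \<nu> \<eta> = hinner (\<psi> \<eta>) (\<psi> \<nu>)"

definition frame_K :: "(real \<times> real \<Rightarrow> 'a::complex_hilbert) \<Rightarrow> real \<times> real \<Rightarrow> real \<times> real \<Rightarrow> real \<times> real \<Rightarrow> complex" where
  "frame_K \<psi> \<eta> \<nu> \<rho> = frame_R \<psi> \<eta> \<rho> * frame_R \<psi> \<rho> \<nu>"

definition Omega :: "(real \<times> real \<Rightarrow> 'a::complex_hilbert) \<Rightarrow> ennreal" where
  "Omega \<psi> = ess_sup lborel (\<lambda>\<nu>. \<integral>\<^sup>+ \<eta>.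
      L1norm (partial1 (frame_K \<psi> \<eta> \<nu>)) + L1norm (partial2 (frame_K \<psi> \<eta> \<nu>))
      + L1norm (partial12 (frame_K \<psi> \<eta> \<nu>)) \<partial>lborel)"

definition continuous_parseval_frame :: "(real \<times> real \<Rightarrow> 'a::complex_hilbert) \<Rightarrow> bool" where
  "continuous_parseval_frame \<psi> \<longleftrightarrow>
     (\<forall>f. (\<lambda>\<eta>. hinner f (\<psi> \<eta>)) \<in> borel_measurable lborel) \<and>
     (\<forall>f. ennreal ((norm f)\<^sup>2) = (\<integral>\<^sup>+ \<eta>. ennreal ((cmod (hinner f (\<psi> \<eta>)))\<^sup>2) \<partial>lborel))"

definition unit_square :: "(real \<times> real) set" where
  "unit_square = cbox (0, 0) (1, 1)"

definition count_N :: "(real \<times> real) set \<Rightarrow> real \<times> real \<Rightarrow> nat" where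
  "count_N \<Lambda> \<rho> = card (\<Lambda> \<inter> ((\<lambda>x. \<rho> + x) ` unit_square))"

definition weight_a :: "(real \<times> real) set \<Rightarrow> real \<times> real \<Rightarrow> real" where
  "weight_a \<Lambda> l = (\<integral> \<rho>. indicator ((\<lambda>x. \<rho> + x) ` unit_square) l / real (count_N \<Lambda> \<rho>) \<partial>lborel)"

definition shift_discrepancy :: "(real \<times> real) set \<Rightarrow> real" where
  "shift_discrepancy \<Lambda> = (SUP \<rho>. SUP \<eta>\<in>unit_square.
      \<bar>real (card (\<Lambda> \<inter> ((\<lambda>x. \<rho> + x) ` cbox (0, 0) \<eta>))) / real (count_N \<Lambda> \<rho>)
        - fst \<eta> * snd \<eta>\<bar>)"

definition is_frame :: "'i set \<Rightarrow> ('i \<Rightarrow> 'a::complex_hilbert) \<Rightarrow> real \<Rightarrow> real \<Rightarrow> bool" where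
  "is_frame I \<phi> A B \<longleftrightarrow> (\<forall>f.
     (\<lambda>i. (cmod (hinner f (\<phi> i)))\<^sup>2) summable_on I \<and>
     A * (norm f)\<^sup>2 \<le> (\<Sum>\<^sub>\<infinity>i\<in>I. (cmod (hinner f (\<phi> i)))\<^sup>2) \<and>
     (\<Sum>\<^sub>\<infinity>i\<in>I. (cmod (hinner f (\<phi> i)))\<^sup>2) \<le> B * (norm f)\<^sup>2)"

end

theory Submission
  imports Defs
begin

text \<open>
  For \<open>F(x) = \<langle>f, \<psi>\<^sub>x\<rangle>\<close> the reproducing formula
  \<open>F(x) = \<integral> F(\<nu>) \<langle>\<psi>\<^sub>\<nu>, \<psi>\<^sub>x\<rangle> d\<nu>\<close> gives
  \<open>|F(x)|\<^sup>2 = \<integral>\<integral> F(\<nu>) cnj(F(\<eta>)) K(x) d\<eta> d\<nu>\<close> with \<open>K\<close> taken at \<open>(\<eta>, \<nu>)\<close>.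
  The Koksma-Hlawka inequality for \<open>K\<close> on each square \<open>\<rho> + [0,1]\<^sup>2\<close> compares the average of
  \<open>|F|\<^sup>2\<close> over the sampling points in the square with its integral over the square.
  Integrating over \<open>\<rho>\<close> turns the two sides into \<open>\<Sum> a\<^sub>\<lambda> |F(\<lambda>)|\<^sup>2\<close> and \<open>\<parallel>f\<parallel>\<^sup>2\<close>, and the total
  error is at most \<open>D \<Omega> \<parallel>f\<parallel>\<^sup>2\<close> by Schur's test.
  Since \<open>\<psi>\<close> may be unbounded, Fubini's theorem is applied only after cutting \<open>F\<close> down to the bounded sets
  where \<open>\<psi>\<close> is bounded; the cut-offs are removed by Fatou's lemma.
\<close>

subsection \<open>Hilbert space and frame preliminaries\<close>

text \<open>The integral over \<open>\<nu>\<close>, \<open>\<eta>\<close> and x need not converge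
  absolutely: the operator with kernel R is a projection, but the one with kernel |R| may be
  unbounded. On a cut-off set Parseval bounds the x-integral of |K| by the norms of the frame
  vectors. The price is that a cut-off coefficient function G is no longer a coefficient function of
  a vector. What gets sampled is its projection \<open>synth G\<close>, while the error term carries
  the norm of G itself. The upper frame bound survives Fatou because the projection is a
  contraction. For the lower bound, Fatou goes the right way for the continuous norm but the wrong
  way for the sampled sum. The sampled energy of the cut-off is therefore compared with that of f
  through the tail, and the tail is controlled by the upper bound, which is why that bound is proved
  for restriction to an arbitrary Borel set. The constant is exactly D times \<open>Omega\<close>:
  as the square moves over the plane, its upper edges sweep the plane too, so the two edge integrals
  and the area integral each yield a full L1 norm with factor 1.\<close>

lemma hinner_add_right: "hinner x (y + z :: 'a::complex_hilbert) = hinner x y + hinner x z"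
  by (metis hinner_add_left hinner_conj complex_cnj_add)

lemma hinner_scaleC_right: "hinner x (hscaleC c y :: 'a::complex_hilbert) = cnj c * hinner x y"
  by (metis hinner_scaleC_left hinner_conj complex_cnj_mult)

lemma hinner_scaleR_right: "hinner x (r *\<^sub>R y :: 'a::complex_hilbert) = complex_of_real r * hinner x y"
  by (metis hinner_scaleC_right hscaleC_of_real complex_cnj_complex_of_real)

lemma hinner_diff_right: "hinner x (y - z :: 'a::complex_hilbert) = hinner x y - hinner x z"
  by (metis add_diff_cancel diff_add_cancel hinner_add_right)

lemma hinner_zero_right [simp]: "hinner x (0 :: 'a::complex_hilbert) = 0"
  using hinner_diff_right[of x x x] by simp

lemma norm_add_square:
  "(norm (x + y :: 'a::complex_hilbert))\<^sup>2 = (norm x)\<^sup>2 + (norm y)\<^sup>2 + 2 * Re (hinner x y)"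
proof -
  have "complex_of_real ((norm (x + y))\<^sup>2)
      = complex_of_real ((norm x)\<^sup>2) + complex_of_real ((norm y)\<^sup>2) + (hinner x y + cnj (hinner x y))"
    using hinner_conj[of y x]
    by (simp add: hinner_norm[symmetric] hinner_add_left hinner_add_right del: of_real_power)
  then have "Re (complex_of_real ((norm (x + y))\<^sup>2))
      = Re (complex_of_real ((norm x)\<^sup>2) + complex_of_real ((norm y)\<^sup>2) + (hinner x y + cnj (hinner x y)))"
    by simp
  then show ?thesis by simp
qed

lemma norm_hscaleC: "norm (hscaleC c x :: 'a::complex_hilbert) = cmod c * norm x"
proof -
  have "complex_of_real ((norm (hscaleC c x))\<^sup>2) = complex_of_real ((cmod c * norm x)\<^sup>2)"
    by (simp add: hinner_norm[symmetric] hinner_scaleC_left hinner_scaleC_right power_mult_distrib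
        complex_norm_square[of c] del: of_real_power)
  then show ?thesis
    by (metis of_real_eq_iff norm_ge_zero mult_nonneg_nonneg power2_eq_iff_nonneg)
qed

lemma hinner_Cauchy_Schwarz: "cmod (hinner x y) \<le> norm x * norm (y :: 'a::complex_hilbert)"
proof (cases "y = 0")
  case False
  \<comment> \<open>This scalar makes x + cy orthogonal to y, hence of minimal norm.\<close>
  define c where "c = - (hinner x y / complex_of_real ((norm y)\<^sup>2))"
  have ny: "norm y \<noteq> 0" using False by simp
  have "0 \<le> (norm (x + hscaleC c y))\<^sup>2" by simp
  also have "\<dots> = (norm x)\<^sup>2 + (cmod c * norm y)\<^sup>2 + 2 * Re (cnj c * hinner x y)"
    by (simp add: norm_add_square norm_hscaleC hinner_scaleC_right)
  also have "cnj c * hinner x y = - complex_of_real ((cmod (hinner x y))\<^sup>2 / (norm y)\<^sup>2)"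
    unfolding c_def of_real_divide complex_norm_square by (simp add: divide_simps)
  also have "(cmod c * norm y)\<^sup>2 = (cmod (hinner x y))\<^sup>2 / (norm y)\<^sup>2"
    unfolding c_def using ny by (simp add: norm_divide norm_mult power2_eq_square)
  finally have "(cmod (hinner x y))\<^sup>2 \<le> (norm x * norm y)\<^sup>2"
    using ny by (simp add: field_simps)
  then show ?thesis
    by (rule power2_le_imp_le) simp
qed simp

lemma tendsto_hinner_right:
  fixes y :: "'a::complex_hilbert"
  assumes "(X \<longlongrightarrow> y) Fl"
  shows "((\<lambda>n. hinner x (X n)) \<longlongrightarrow> hinner x y) Fl"
proof (rule Lim_null_comparison[where g = "\<lambda>n. norm x * norm (X n - y)", THEN LIM_zero_cancel])
  show "\<forall>\<^sub>F n in Fl. cmod (hinner x (X n) - hinner x y) \<le> norm x * norm (X n - y)"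
    by (auto simp: hinner_diff_right[symmetric] hinner_Cauchy_Schwarz)
  show "((\<lambda>n. norm x * norm (X n - y)) \<longlongrightarrow> 0) Fl"
    using tendsto_mult_right_zero tendsto_norm_zero LIM_zero assms by metis
qed

section \<open>Measurability and the reproducing formula of a Parseval frame\<close>

locale parseval_frame =
  fixes \<psi> :: "real \<times> real \<Rightarrow> 'a::complex_hilbert"
  assumes separable: "separable_space TYPE('a)"
    and parseval: "continuous_parseval_frame \<psi>"
begin

lemma measurable_hinner_frame [measurable]: "(\<lambda>\<eta>. hinner f (\<psi> \<eta>)) \<in> borel_measurable borel"
  using parseval unfolding continuous_parseval_frame_def by simp

lemma parseval_nn: "(\<integral>\<^sup>+ \<eta>. ennreal ((cmod (hinner f (\<psi> \<eta>)))\<^sup>2) \<partial>lborel) = ennreal ((norm f)\<^sup>2)"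
  using parseval unfolding continuous_parseval_frame_def by simp

lemma measurable_frame_hinner [measurable]: "(\<lambda>\<eta>. hinner (\<psi> \<eta>) f) \<in> borel_measurable borel"
proof -
  have "(\<lambda>\<eta>. cnj (hinner f (\<psi> \<eta>))) \<in> borel_measurable borel"
    by (rule measurable_compose[OF measurable_hinner_frame borel_measurable_continuous_onI])
      (intro continuous_intros)
  then show ?thesis by (simp add: hinner_conj[symmetric])
qed

text \<open>Only weak measurability is given. A norm bound is equivalent to the Cauchy-Schwarz
  bounds against a countable dense set, so it becomes countably many scalar conditions; separability
  enters here. The shift by c serves the choice of a nearby dense vector in
  \<open>measurable_hinner_pair\<close>.\<close>

lemma measurable_norm_frame_diff [measurable]: "(\<lambda>\<eta>. norm (\<psi> \<eta> - c)) \<in> borel_measurable borel"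
  unfolding borel_measurable_iff_le
proof
  fix r :: real
  obtain D :: "'a set" where D: "countable D" "closure D = UNIV"
    using separable unfolding separable_space_def by auto
  \<comment> \<open>The conjunct \<open>0 \<le> r\<close> treats negative r: in the zero space the
    inequalities over D hold for every r.\<close>
  have eq: "norm v \<le> r \<longleftrightarrow> 0 \<le> r \<and> (\<forall>d\<in>D. cmod (hinner d v) \<le> r * norm d)" for v
  proof
    assume "norm v \<le> r"
    moreover have "cmod (hinner d v) \<le> r * norm d" for d
      using hinner_Cauchy_Schwarz[of d v] mult_left_mono[OF \<open>norm v \<le> r\<close> norm_ge_zero[of d]]
      by (simp add: mult.commute)
    ultimately show "0 \<le> r \<and> (\<forall>d\<in>D. cmod (hinner d v) \<le> r * norm d)"
      using norm_ge_zero[of v] order_trans by blast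
  next
    assume *: "0 \<le> r \<and> (\<forall>d\<in>D. cmod (hinner d v) \<le> r * norm d)"
    have "v \<in> closure D" using D by simp
    then obtain X where X: "\<And>n. X n \<in> D" "X \<longlonglongrightarrow> v"
      unfolding closure_sequential by auto
    have "(\<lambda>n. cmod (hinner (X n) v)) \<longlonglongrightarrow> cmod (hinner v v)"
      using tendsto_norm[OF tendsto_hinner_right[OF X(2), of v]]
      by (metis (no_types, lifting) ext complex_mod_cnj hinner_conj)
    moreover have "(\<lambda>n. r * norm (X n)) \<longlonglongrightarrow> r * norm v"
      by (intro tendsto_intros X)
    ultimately have "cmod (hinner v v) \<le> r * norm v"
      by (rule LIMSEQ_le) (use * X in auto)
    then have "norm v * norm v \<le> r * norm v"
      by (simp add: hinner_norm power2_eq_square norm_mult)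
    then show "norm v \<le> r"
      using * by (cases "v = 0") auto
  qed
  have "{w \<in> space borel. norm (\<psi> w - c) \<le> r}
     = {w \<in> space borel. 0 \<le> r \<and> (\<forall>d\<in>D. cmod (hinner d (\<psi> w) - hinner d c) \<le> r * norm d)}"
    unfolding eq hinner_diff_right by simp
  also have "\<dots> \<in> sets borel"
    using D(1) by measurable
  finally show "{w \<in> space borel. norm (\<psi> w - c) \<le> r} \<in> sets borel" .
qed

lemma measurable_norm_frame [measurable]: "(\<lambda>\<eta>. norm (\<psi> \<eta>)) \<in> borel_measurable borel"
  using measurable_norm_frame_diff[of 0] by simp

text \<open>Measurability in each argument separately does not give joint measurability, which
  Fubini's theorem requires of R. The second vector is replaced by a dense vector within distance
  1/(m+1), so only countably many values occur in that slot and each of them leaves a function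
  measurable in the first argument. Strong convergence then carries measurability to the
  limit.\<close>

lemma measurable_hinner_pair:
  "(\<lambda>p. hinner (\<psi> (fst p)) (\<psi> (snd p))) \<in> borel_measurable (borel \<Otimes>\<^sub>M borel)"
proof -
  obtain D :: "'a set" where D: "countable D" "closure D = UNIV"
    using separable unfolding separable_space_def by auto
  have "D \<noteq> {}" using D by auto
  define d where "d = from_nat_into D"
  have rd: "range d = D" unfolding d_def using D \<open>D \<noteq> {}\<close> by simp
  \<comment> \<open>Taking the least admissible index makes the choice a measurable function of
    \<open>\<nu>\<close>.\<close>
  define k where "k m \<nu> = (LEAST j. norm (\<psi> \<nu> - d j) < inverse (real (Suc m)))" for m \<nu>
  have k: "norm (\<psi> \<nu> - d (k m \<nu>)) < inverse (real (Suc m))" for m \<nu>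
  proof -
    have "\<psi> \<nu> \<in> closure D" using D by simp
    then obtain y where "y \<in> D" "dist y (\<psi> \<nu>) < inverse (real (Suc m))"
      unfolding closure_approachable by (metis inverse_positive_iff_positive of_nat_0_less_iff zero_less_Suc)
    then obtain j where "norm (\<psi> \<nu> - d j) < inverse (real (Suc m))"
      using rd by (metis dist_commute dist_norm imageE)
    then show ?thesis unfolding k_def by (rule LeastI)
  qed
  have km [measurable]: "k m \<in> measurable borel (count_space UNIV)" for m
    unfolding k_def by measurable
  show ?thesis
  proof (rule borel_measurable_LIMSEQ_metric)
    fix m
    show "(\<lambda>p. hinner (\<psi> (fst p)) (d (k m (snd p)))) \<in> borel_measurable (borel \<Otimes>\<^sub>M borel)"
      by (rule measurable_compose_countable[where g = "\<lambda>p. k m (snd p)"]) measurable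
  next
    fix p :: "(real \<times> real) \<times> (real \<times> real)"
    have "(\<lambda>m. d (k m (snd p)) - \<psi> (snd p)) \<longlonglongrightarrow> 0"
      by (rule Lim_null_comparison[OF _ LIMSEQ_inverse_real_of_nat])
        (use k[of "snd p"] in \<open>auto simp: norm_minus_commute less_imp_le\<close>)
    then show "(\<lambda>m. hinner (\<psi> (fst p)) (d (k m (snd p)))) \<longlonglongrightarrow> hinner (\<psi> (fst p)) (\<psi> (snd p))"
      by (intro tendsto_hinner_right) (rule LIM_zero_cancel)
  qed
qed

lemma measurable_hinner_frames [measurable]:
  assumes [measurable]: "g \<in> measurable M borel" "h \<in> measurable M borel"
  shows "(\<lambda>\<omega>. hinner (\<psi> (g \<omega>)) (\<psi> (h \<omega>))) \<in> borel_measurable M"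
  using measurable_compose[OF measurable_Pair[OF assms] measurable_hinner_pair] by simp

lemma integrable_frame_square: "integrable lborel (\<lambda>x. (cmod (hinner f (\<psi> x)))\<^sup>2)"
  by (rule integrableI_nonneg) (auto simp: parseval_nn)

lemma integral_frame_square: "(\<integral>x. (cmod (hinner f (\<psi> x)))\<^sup>2 \<partial>lborel) = (norm f)\<^sup>2"
  using nn_integral_eq_integral[OF integrable_frame_square[of f]] parseval_nn[of f] by simp

lemma integrable_frame_product: "integrable lborel (\<lambda>x. hinner f (\<psi> x) * hinner (\<psi> x) g)"
proof (rule Bochner_Integration.integrable_bound)
  show "integrable lborel (\<lambda>x. (cmod (hinner f (\<psi> x)))\<^sup>2 + (cmod (hinner g (\<psi> x)))\<^sup>2)"
    by (intro Bochner_Integration.integrable_add integrable_frame_square)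
  have "cmod (hinner f (\<psi> x)) * cmod (hinner g (\<psi> x)) \<le> (cmod (hinner f (\<psi> x)))\<^sup>2 + (cmod (hinner g (\<psi> x)))\<^sup>2" for x
    using sum_squares_bound[of "cmod (hinner f (\<psi> x))" "cmod (hinner g (\<psi> x))"]
     mult_nonneg_nonneg[OF norm_ge_zero[of "hinner f (\<psi> x)"] norm_ge_zero[of "hinner g (\<psi> x)"]] by linarith
  moreover have "cmod (hinner (\<psi> x) g) = cmod (hinner g (\<psi> x))" for x
    by (metis complex_mod_cnj hinner_conj)
  ultimately show "AE x in lborel. norm (hinner f (\<psi> x) * hinner (\<psi> x) g)
      \<le> norm ((cmod (hinner f (\<psi> x)))\<^sup>2 + (cmod (hinner g (\<psi> x)))\<^sup>2)"
    by (auto simp: norm_mult)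
qed measurable

text \<open>Polarization: Parseval for f + g is expanded on both sides and the square terms
  cancel.\<close>

lemma parseval_Re: "(\<integral>x. Re (hinner f (\<psi> x) * hinner (\<psi> x) g) \<partial>lborel) = Re (hinner f g)"
proof -
  have "(norm (f + g))\<^sup>2 = (\<integral>x. (cmod (hinner f (\<psi> x)))\<^sup>2 + (cmod (hinner g (\<psi> x)))\<^sup>2
      + 2 * Re (hinner f (\<psi> x) * hinner (\<psi> x) g) \<partial>lborel)"
    unfolding integral_frame_square[symmetric] hinner_add_left
  proof (rule Bochner_Integration.integral_cong[OF refl])
    fix x
    have "hinner (\<psi> x) g = cnj (hinner g (\<psi> x))" by (rule hinner_conj)
    then show "(cmod (hinner f (\<psi> x) + hinner g (\<psi> x)))\<^sup>2 = (cmod (hinner f (\<psi> x)))\<^sup>2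
        + (cmod (hinner g (\<psi> x)))\<^sup>2 + 2 * Re (hinner f (\<psi> x) * hinner (\<psi> x) g)"
      unfolding cmod_power2 by (simp add: power2_eq_square algebra_simps)
  qed
  also have "\<dots> = (norm f)\<^sup>2 + (norm g)\<^sup>2 + 2 * (\<integral>x. Re (hinner f (\<psi> x) * hinner (\<psi> x) g) \<partial>lborel)"
    using integrable_frame_product[of f g]
    by (simp add: integrable_frame_square integral_frame_square del: times_complex.simps)
  finally show ?thesis
    unfolding norm_add_square by simp
qed

lemma reproducing: "(\<integral>x. hinner f (\<psi> x) * hinner (\<psi> x) g \<partial>lborel) = hinner f g"
proof (rule complex_eqI)
  note I = integrable_frame_product[of f g]
  show "Re (\<integral>x. hinner f (\<psi> x) * hinner (\<psi> x) g \<partial>lborel) = Re (hinner f g)"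
    using parseval_Re[of f g] integral_Re[OF I] by simp
  \<comment> \<open>Im z = Re(-iz), so the imaginary part is the real identity for the vector
    -if.\<close>
  have "Re (hinner (hscaleC (- \<i>) f) (\<psi> x) * hinner (\<psi> x) g) = Im (hinner f (\<psi> x) * hinner (\<psi> x) g)" for x
    by (simp add: hinner_scaleC_left)
  then show "Im (\<integral>x. hinner f (\<psi> x) * hinner (\<psi> x) g \<partial>lborel) = Im (hinner f g)"
    using parseval_Re[of "hscaleC (- \<i>) f" g] integral_Im[OF I] by (simp add: hinner_scaleC_left)
qed

end

subsection \<open>The Koksma-Hlawka inequality\<close>

lemma has_cont_mixed_partialsD:
  assumes "has_cont_mixed_partials K"
  shows "continuous_on UNIV (partial1 K)" "continuous_on UNIV (partial2 K)" "continuous_on UNIV (partial12 K)"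
    and "((\<lambda>s. K (s, y)) has_vector_derivative partial1 K (x, y)) (at x)"
    and "((\<lambda>t. K (x, t)) has_vector_derivative partial2 K (x, y)) (at y)"
    and "((\<lambda>t. partial1 K (x, t)) has_vector_derivative partial12 K (x, y)) (at y)"
proof -
  obtain D1 D2 D12 where c: "continuous_on UNIV D1" "continuous_on UNIV D2" "continuous_on UNIV D12"
    and d1: "\<And>x y. ((\<lambda>s. K (s, y)) has_vector_derivative D1 (x, y)) (at x)"
    and d2: "\<And>x y. ((\<lambda>t. K (x, t)) has_vector_derivative D2 (x, y)) (at y)"
    and d12: "\<And>x y. ((\<lambda>t. D1 (x, t)) has_vector_derivative D12 (x, y)) (at y)"
    using assms unfolding has_cont_mixed_partials_def by blast
  have 1: "partial1 K = D1"
    by (rule ext) (auto simp: partial1_def intro!: vector_derivative_at d1 split: prod.splits)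
  have 2: "partial2 K = D2"
    by (rule ext) (auto simp: partial2_def intro!: vector_derivative_at d2 split: prod.splits)
  have 12: "partial12 K = D12"
    unfolding partial12_def 1
    by (rule ext) (auto simp: partial2_def intro!: vector_derivative_at d12 split: prod.splits)
  show "continuous_on UNIV (partial1 K)" "continuous_on UNIV (partial2 K)" "continuous_on UNIV (partial12 K)"
    "((\<lambda>s. K (s, y)) has_vector_derivative partial1 K (x, y)) (at x)"
    "((\<lambda>t. K (x, t)) has_vector_derivative partial2 K (x, y)) (at y)"
    "((\<lambda>t. partial1 K (x, t)) has_vector_derivative partial12 K (x, y)) (at y)"
    unfolding 1 2 12 by (fact c d1 d2 d12)+
qed

text \<open>The double integral of the mixed derivative is the alternating sum of K over the four
  corners of the rectangle. The expansion is anchored at the upper corner so that the point enters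
  only through conditions of the form x \<le> s and y \<le> t. Integrated over the point, these
  become masses of boxes growing from the lower left corner, which is what the discrepancy
  measures.\<close>

lemma upper_corner_expansion:
  assumes K: "has_cont_mixed_partials K" and "x \<le> a" "y \<le> b"
  shows "K (x, y) = K (a, b) - (\<integral>s. indicator {x..a} s *\<^sub>R partial1 K (s, b) \<partial>lborel)
      - (\<integral>t. indicator {y..b} t *\<^sub>R partial2 K (a, t) \<partial>lborel)
      + (\<integral>p. indicator ({x..a} \<times> {y..b}) p *\<^sub>R partial12 K p \<partial>lborel)"
proof -
  note [continuous_intros] = has_cont_mixed_partialsD(1-3)[OF K, THEN continuous_on_compose2]
  note deriv = has_cont_mixed_partialsD(4-6)[OF K, THEN has_vector_derivative_at_within]
  have 1: "(\<integral>s. indicator {x..a} s *\<^sub>R partial1 K (s, t) \<partial>lborel) = K (a, t) - K (x, t)" for t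
    by (rule integral_FTC_Icc[where F = "\<lambda>s. K (s, t)"]) (auto intro!: continuous_intros deriv assms)
  have 2: "(\<integral>t. indicator {y..b} t *\<^sub>R partial2 K (a, t) \<partial>lborel) = K (a, b) - K (a, y)"
    by (rule integral_FTC_Icc[where F = "\<lambda>t. K (a, t)"]) (auto intro!: continuous_intros deriv assms)
  have 12: "(\<integral>t. indicator {y..b} t *\<^sub>R partial12 K (s, t) \<partial>lborel) = partial1 K (s, b) - partial1 K (s, y)" for s
    by (rule integral_FTC_Icc[where F = "\<lambda>t. partial1 K (s, t)"]) (auto intro!: continuous_intros deriv assms)
  have I: "integrable (lborel \<Otimes>\<^sub>M lborel) (\<lambda>p. indicator ({x..a} \<times> {y..b}) p *\<^sub>R partial12 K p)"
    unfolding lborel_prod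
    by (rule borel_integrable_compact) (auto intro!: compact_Times continuous_intros)
  have i1: "integrable lborel (\<lambda>s. indicator {x..a} s *\<^sub>R partial1 K (s, t))" for t
    by (rule borel_integrable_compact) (auto intro!: continuous_intros)
  have "(\<integral>p. indicator ({x..a} \<times> {y..b}) p *\<^sub>R partial12 K p \<partial>lborel)
     = (\<integral>s. (\<integral>t. indicator ({x..a} \<times> {y..b}) (s, t) *\<^sub>R partial12 K (s, t) \<partial>lborel) \<partial>lborel)"
    using lborel_pair.integral_fst'[OF I] by (simp add: lborel_prod)
  also have "\<dots> = (\<integral>s. indicator {x..a} s *\<^sub>R partial1 K (s, b) - indicator {x..a} s *\<^sub>R partial1 K (s, y) \<partial>lborel)"
    by (simp add: indicator_times 12[symmetric] scaleR_diff_right[symmetric] flip: scaleR_scaleR)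
  also have "\<dots> = (K (a, b) - K (x, b)) - (K (a, y) - K (x, y))"
    using i1 by (simp add: 1)
  finally show ?thesis
    unfolding 1 2 by simp
qed

text \<open>Meant for integrating the corner expansion over the point \<open>\<omega>\<close>: the
  derivative k depends on s alone, so after the interchange only the mass of the slice of A remains
  as a factor.\<close>

lemma Fubini_indicator:
  fixes k :: "'b \<Rightarrow> 'c::{banach, second_countable_topology}"
  assumes M: "finite_measure M" and N: "sigma_finite_measure N"
    and k: "integrable N k" and A [measurable]: "A \<in> sets (M \<Otimes>\<^sub>M N)"
  shows "integrable M (\<lambda>\<omega>. \<integral>s. indicator A (\<omega>, s) *\<^sub>R k s \<partial>N)" (is ?integrable)
    and "integrable N (\<lambda>s. measure M {\<omega> \<in> space M. (\<omega>, s) \<in> A} *\<^sub>R k s)" (is ?integrable')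
    and "(\<integral>\<omega>. (\<integral>s. indicator A (\<omega>, s) *\<^sub>R k s \<partial>N) \<partial>M)
       = (\<integral>s. measure M {\<omega> \<in> space M. (\<omega>, s) \<in> A} *\<^sub>R k s \<partial>N)" (is ?eq)
proof -
  interpret M: finite_measure M by fact
  interpret N: sigma_finite_measure N by fact
  interpret P: pair_sigma_finite M N ..
  have [measurable]: "k \<in> borel_measurable N" using k by auto
  have kk: "integrable (M \<Otimes>\<^sub>M N) (\<lambda>z. k (snd z))"
    by (rule P.Fubini_integrable) (use k in auto)
  have I: "integrable (M \<Otimes>\<^sub>M N) (\<lambda>(\<omega>, s). indicator A (\<omega>, s) *\<^sub>R k s)"
    by (rule Bochner_Integration.integrable_bound[OF kk]) (auto split: split_indicator)
  have *: "(\<integral>\<omega>. indicator A (\<omega>, s) *\<^sub>R k s \<partial>M) = measure M {\<omega> \<in> space M. (\<omega>, s) \<in> A} *\<^sub>R k s"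
    if "s \<in> space N" for s
  proof -
    have "(\<integral>\<omega>. indicator A (\<omega>, s) *\<^sub>R k s \<partial>M) = (\<integral>\<omega>. indicator {\<omega> \<in> space M. (\<omega>, s) \<in> A} \<omega> *\<^sub>R k s \<partial>M)"
      by (intro Bochner_Integration.integral_cong) (auto split: split_indicator)
    then show ?thesis using that by (simp add: M.emeasure_eq_measure)
  qed
  show ?integrable by (rule P.integrable_fst[OF I])
  show ?integrable'
    using P.integrable_snd[OF I] by (subst Bochner_Integration.integrable_cong[OF refl *[symmetric]]) auto
  show ?eq
    using P.Fubini_integral[OF I] Bochner_Integration.integral_cong[OF refl *, of N] by simp
qed

text \<open>By Fubini the difference is a single integral of k against the difference of slice
  masses. That difference has to be bounded only where k is nonzero, because k will be a derivative
  cut off to a square and the discrepancy says nothing about corners outside it.\<close>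

lemma Fubini_indicator_difference:
  fixes k :: "'b \<Rightarrow> 'c::{banach, second_countable_topology}"
  assumes "finite_measure M1" "finite_measure M2" "sigma_finite_measure N"
    and k: "integrable N k" and A: "A1 \<in> sets (M1 \<Otimes>\<^sub>M N)" "A2 \<in> sets (M2 \<Otimes>\<^sub>M N)"
    and D: "\<And>s. s \<in> space N \<Longrightarrow> k s \<noteq> 0 \<Longrightarrow> \<bar>measure M1 {\<omega> \<in> space M1. (\<omega>, s) \<in> A1}
       - measure M2 {\<omega> \<in> space M2. (\<omega>, s) \<in> A2}\<bar> \<le> D"
  shows "ennreal (norm ((\<integral>\<omega>. (\<integral>s. indicator A1 (\<omega>, s) *\<^sub>R k s \<partial>N) \<partial>M1)
     - (\<integral>\<omega>. (\<integral>s. indicator A2 (\<omega>, s) *\<^sub>R k s \<partial>N) \<partial>M2))) \<le> ennreal D * (\<integral>\<^sup>+ s. ennreal (norm (k s)) \<partial>N)"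
proof -
  let ?m = "\<lambda>s. measure M1 {\<omega> \<in> space M1. (\<omega>, s) \<in> A1} - measure M2 {\<omega> \<in> space M2. (\<omega>, s) \<in> A2}"
  note F1 = Fubini_indicator[OF assms(1,3) k A(1)] and F2 = Fubini_indicator[OF assms(2,3) k A(2)]
  have I: "integrable N (\<lambda>s. ?m s *\<^sub>R k s)"
    using Bochner_Integration.integrable_diff[OF F1(2) F2(2)] by (simp add: scaleR_diff_left)
  have "(\<integral>\<omega>. (\<integral>s. indicator A1 (\<omega>, s) *\<^sub>R k s \<partial>N) \<partial>M1)
     - (\<integral>\<omega>. (\<integral>s. indicator A2 (\<omega>, s) *\<^sub>R k s \<partial>N) \<partial>M2) = (\<integral>s. ?m s *\<^sub>R k s \<partial>N)"
    unfolding F1(3) F2(3) using F1(2) F2(2) by (simp add: scaleR_diff_left)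
  moreover have "ennreal (norm (\<integral>s. ?m s *\<^sub>R k s \<partial>N)) \<le> (\<integral>\<^sup>+ s. norm (?m s *\<^sub>R k s) \<partial>N)"
    by (rule integral_norm_bound_ennreal[OF I])
  moreover have "\<dots> \<le> (\<integral>\<^sup>+ s. ennreal D * ennreal (norm (k s)) \<partial>N)"
  proof (rule nn_integral_mono)
    fix s assume s: "s \<in> space N"
    show "ennreal (norm (?m s *\<^sub>R k s)) \<le> ennreal D * ennreal (norm (k s))"
    proof (cases "k s = 0")
      case False
      then show ?thesis using D[OF s False]
        by (subst ennreal_mult''[symmetric]) (auto intro!: ennreal_leI mult_right_mono)
    qed simp
  qed
  moreover have "\<dots> = ennreal D * (\<integral>\<^sup>+ s. ennreal (norm (k s)) \<partial>N)"
    using k by (intro nn_integral_cmult) auto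
  ultimately show ?thesis by simp
qed

text \<open>Both measures have mass 1 and live on the same square, so the corner value of K cancels
  and the three derivative terms of the expansion are compared one by one. Stating this for two
  measures treats the counting measure on the sample points and Lebesgue measure alike;
  measurability of the identity is asked for because their sigma-algebras differ.\<close>

lemma Koksma_Hlawka_measures:
  fixes K :: "real \<times> real \<Rightarrow> complex" and a b D :: real and M1 M2 :: "(real \<times> real) measure"
  defines "Q \<equiv> {a..a+1} \<times> {b..b+1}"
  assumes K: "has_cont_mixed_partials K"
    and M1: "emeasure M1 (space M1) = 1" "(\<lambda>x. x) \<in> measurable M1 borel" "space M1 \<subseteq> Q"
    and M2: "emeasure M2 (space M2) = 1" "(\<lambda>x. x) \<in> measurable M2 borel" "space M2 \<subseteq> Q"
    and D: "\<And>s t. (s, t) \<in> Q \<Longrightarrow> \<bar>measure M1 {x \<in> space M1. fst x \<le> s \<and> snd x \<le> t}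
        - measure M2 {x \<in> space M2. fst x \<le> s \<and> snd x \<le> t}\<bar> \<le> D"
  shows "ennreal (norm ((\<integral>x. K x \<partial>M1) - (\<integral>x. K x \<partial>M2))) \<le> ennreal D *
     ((\<integral>\<^sup>+ s. ennreal (norm (partial1 K (s, b + 1))) * indicator {a..a+1} s \<partial>lborel)
    + (\<integral>\<^sup>+ t. ennreal (norm (partial2 K (a + 1, t))) * indicator {b..b+1} t \<partial>lborel)
    + (\<integral>\<^sup>+ p. ennreal (norm (partial12 K p)) * indicator Q p \<partial>lborel))"
proof -
  note [continuous_intros] = has_cont_mixed_partialsD(1-3)[OF K, THEN continuous_on_compose2]
  define k1 where "k1 s = indicator {a..a+1} s *\<^sub>R partial1 K (s, b + 1)" for s
  define k2 where "k2 t = indicator {b..b+1} t *\<^sub>R partial2 K (a + 1, t)" for t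
  define k12 where "k12 p = indicator Q p *\<^sub>R partial12 K p" for p
  have ik1: "integrable lborel k1"
    unfolding k1_def by (rule borel_integrable_compact) (auto intro!: continuous_intros)
  have ik2: "integrable lborel k2"
    unfolding k2_def by (rule borel_integrable_compact) (auto intro!: continuous_intros)
  have ik12: "integrable lborel k12"
    unfolding k12_def Q_def by (rule borel_integrable_compact) (auto intro!: continuous_intros compact_Times)
  \<comment> \<open>These sets encode the lower limits of the three integrals in the expansion. They
    depend on M because they must lie in the space of the product measure.\<close>
  define A1 where "A1 M = {z \<in> space (M \<Otimes>\<^sub>M lborel). fst (fst z) \<le> (snd z :: real)}" for M :: "(real \<times> real) measure"
  define A2 where "A2 M = {z \<in> space (M \<Otimes>\<^sub>M lborel). snd (fst z) \<le> (snd z :: real)}" for M :: "(real \<times> real) measure"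
  define A12 where "A12 M = {z \<in> space (M \<Otimes>\<^sub>M lborel). fst (fst z) \<le> fst (snd z) \<and> snd (fst z) \<le> (snd (snd z) :: real)}"
    for M :: "(real \<times> real) measure"
  have sets: "A1 M \<in> sets (M \<Otimes>\<^sub>M lborel)" "A2 M \<in> sets (M \<Otimes>\<^sub>M lborel)" "A12 M \<in> sets (M \<Otimes>\<^sub>M lborel)"
    if m: "(\<lambda>x. x) \<in> measurable M borel" for M
  proof -
    let ?P = "M \<Otimes>\<^sub>M (lborel :: real measure)" and ?P2 = "M \<Otimes>\<^sub>M (lborel :: (real \<times> real) measure)"
    have c: "continuous_on UNIV (\<lambda>x :: real \<times> real. fst x)" "continuous_on UNIV (\<lambda>x :: real \<times> real. snd x)"
      by (rule continuous_on_fst continuous_on_snd, rule continuous_on_id)+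
    have f: "(\<lambda>x. fst x) \<in> borel_measurable M" "(\<lambda>x. snd x) \<in> borel_measurable M"
      using c[THEN borel_measurable_continuous_onI, THEN measurable_compose[OF m]] .
    have l: "(\<lambda>z. snd z) \<in> borel_measurable ?P" by simp
    have c': "(\<lambda>x. fst x) \<in> borel_measurable (lborel :: (real \<times> real) measure)"
      "(\<lambda>x. snd x) \<in> borel_measurable (lborel :: (real \<times> real) measure)"
      using c[THEN borel_measurable_continuous_onI] by simp_all
    note l2 = measurable_compose[OF measurable_snd c'(1)] measurable_compose[OF measurable_snd c'(2)]
    note f1 = measurable_compose[OF measurable_fst f(1)] and f2 = measurable_compose[OF measurable_fst f(2)]
    show "A1 M \<in> sets ?P" "A2 M \<in> sets ?P" "A12 M \<in> sets ?P2"
      unfolding A1_def A2_def A12_def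
      by (rule sets.sets_Collect_conj borel_measurable_le f1 f2 l l2)+
  qed
  define T1 where "T1 M = (\<integral>x. (\<integral>s. indicator (A1 M) (x, s) *\<^sub>R k1 s \<partial>lborel) \<partial>M)" for M
  define T2 where "T2 M = (\<integral>x. (\<integral>s. indicator (A2 M) (x, s) *\<^sub>R k2 s \<partial>lborel) \<partial>M)" for M
  define T12 where "T12 M = (\<integral>x. (\<integral>s. indicator (A12 M) (x, s) *\<^sub>R k12 s \<partial>lborel) \<partial>M)" for M
  have fin: "finite_measure M" if "emeasure M (space M) = 1" for M :: "(real \<times> real) measure"
    using that by (intro finite_measureI) simp
  have expand: "(\<integral>x. K x \<partial>M) = K (a + 1, b + 1) - T1 M - T2 M + T12 M"
    if M: "emeasure M (space M) = 1" "(\<lambda>x. x) \<in> measurable M borel" "space M \<subseteq> Q" for M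
  proof -
    interpret finite_measure M by (rule fin) fact
    note I = Fubini_indicator(1)[OF finite_measure_axioms lborel.sigma_finite_measure_axioms]
    have "(\<integral>x. K x \<partial>M) = (\<integral>x. K (a + 1, b + 1) - (\<integral>s. indicator (A1 M) (x, s) *\<^sub>R k1 s \<partial>lborel)
        - (\<integral>s. indicator (A2 M) (x, s) *\<^sub>R k2 s \<partial>lborel) + (\<integral>s. indicator (A12 M) (x, s) *\<^sub>R k12 s \<partial>lborel) \<partial>M)"
    proof (rule Bochner_Integration.integral_cong[OF refl])
      fix p assume p: "p \<in> space M"
      obtain x y where xy: "p = (x, y)" by (cases p)
      have b: "a \<le> x" "x \<le> a + 1" "b \<le> y" "y \<le> b + 1"
        using p M(3) xy unfolding Q_def by auto
      have "indicator (A1 M) (p, s) *\<^sub>R k1 s = indicator {x..a+1} s *\<^sub>R partial1 K (s, b + 1)" for s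
        using p b by (auto simp: A1_def k1_def space_pair_measure xy split: split_indicator)
      moreover have "indicator (A2 M) (p, s) *\<^sub>R k2 s = indicator {y..b+1} s *\<^sub>R partial2 K (a + 1, s)" for s
        using p b by (auto simp: A2_def k2_def space_pair_measure xy split: split_indicator)
      moreover have "indicator (A12 M) (p, s) *\<^sub>R k12 s = indicator ({x..a+1} \<times> {y..b+1}) s *\<^sub>R partial12 K s" for s
        using p b by (auto simp: A12_def k12_def Q_def space_pair_measure xy split: split_indicator)
      ultimately show "K p = K (a + 1, b + 1) - (\<integral>s. indicator (A1 M) (p, s) *\<^sub>R k1 s \<partial>lborel)
        - (\<integral>s. indicator (A2 M) (p, s) *\<^sub>R k2 s \<partial>lborel) + (\<integral>s. indicator (A12 M) (p, s) *\<^sub>R k12 s \<partial>lborel)"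
        using upper_corner_expansion[OF K b(2,4)] xy by simp
    qed
    also have "\<dots> = K (a + 1, b + 1) - T1 M - T2 M + T12 M"
      using I[OF ik1 sets(1)[OF M(2)]] I[OF ik2 sets(2)[OF M(2)]] I[OF ik12 sets(3)[OF M(2)]] M(1)
      by (simp add: T1_def T2_def T12_def measure_def)
    finally show ?thesis .
  qed
  note diff = Fubini_indicator_difference[OF fin[OF M1(1)] fin[OF M2(1)] lborel.sigma_finite_measure_axioms]
  \<comment> \<open>The edge terms concern strips. Since M lives on Q, a strip agrees with the box
    that reaches up to the opposite edge, so the same discrepancy bound covers it.\<close>
  have slice1: "{x \<in> space M. (x, s) \<in> A1 M} = {x \<in> space M. fst x \<le> s \<and> snd x \<le> b + 1}"
    if "space M \<subseteq> Q" for M s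
    using that by (auto simp: A1_def space_pair_measure Q_def)
  have slice2: "{x \<in> space M. (x, t) \<in> A2 M} = {x \<in> space M. fst x \<le> a + 1 \<and> snd x \<le> t}"
    if "space M \<subseteq> Q" for M t
    using that by (auto simp: A2_def space_pair_measure Q_def)
  have slice12: "{x \<in> space M. (x, p) \<in> A12 M} = {x \<in> space M. fst x \<le> fst p \<and> snd x \<le> snd p}" for M p
    by (auto simp: A12_def space_pair_measure)
  have d1: "ennreal (norm (T1 M1 - T1 M2)) \<le> ennreal D * (\<integral>\<^sup>+ s. ennreal (norm (k1 s)) \<partial>lborel)"
    unfolding T1_def
    by (rule diff[OF ik1 sets(1)[OF M1(2)] sets(1)[OF M2(2)]], unfold slice1[OF M1(3)] slice1[OF M2(3)], rule D)
      (auto simp: k1_def Q_def split: split_indicator_asm)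
  have d2: "ennreal (norm (T2 M1 - T2 M2)) \<le> ennreal D * (\<integral>\<^sup>+ s. ennreal (norm (k2 s)) \<partial>lborel)"
    unfolding T2_def
    by (rule diff[OF ik2 sets(2)[OF M1(2)] sets(2)[OF M2(2)]], unfold slice2[OF M1(3)] slice2[OF M2(3)], rule D)
      (auto simp: k2_def Q_def split: split_indicator_asm)
  have d12: "ennreal (norm (T12 M1 - T12 M2)) \<le> ennreal D * (\<integral>\<^sup>+ s. ennreal (norm (k12 s)) \<partial>lborel)"
    unfolding T12_def
    by (rule diff[OF ik12 sets(3)[OF M1(2)] sets(3)[OF M2(2)]], unfold slice12, rule D)
      (auto simp: k12_def split: split_indicator_asm)
  have tri: "norm ((\<integral>x. K x \<partial>M1) - (\<integral>x. K x \<partial>M2))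
       \<le> norm (T1 M1 - T1 M2) + norm (T2 M1 - T2 M2) + norm (T12 M1 - T12 M2)"
  proof -
    have "(\<integral>x. K x \<partial>M1) - (\<integral>x. K x \<partial>M2) = (T12 M1 - T12 M2) - (T1 M1 - T1 M2) - (T2 M1 - T2 M2)"
      unfolding expand[OF M1] expand[OF M2] by simp
    then show ?thesis
      using norm_triangle_ineq4[of "T12 M1 - T12 M2 - (T1 M1 - T1 M2)" "T2 M1 - T2 M2"]
        norm_triangle_ineq4[of "T12 M1 - T12 M2" "T1 M1 - T1 M2"] by simp
  qed
  have k: "(\<integral>\<^sup>+ s. ennreal (norm (k1 s)) \<partial>lborel)
      = (\<integral>\<^sup>+ s. ennreal (norm (partial1 K (s, b + 1))) * indicator {a..a+1} s \<partial>lborel)"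
    "(\<integral>\<^sup>+ s. ennreal (norm (k2 s)) \<partial>lborel)
      = (\<integral>\<^sup>+ t. ennreal (norm (partial2 K (a + 1, t))) * indicator {b..b+1} t \<partial>lborel)"
    "(\<integral>\<^sup>+ s. ennreal (norm (k12 s)) \<partial>lborel) = (\<integral>\<^sup>+ p. ennreal (norm (partial12 K p)) * indicator Q p \<partial>lborel)"
    unfolding k1_def k2_def k12_def by (auto intro!: nn_integral_cong split: split_indicator)
  have "ennreal (norm ((\<integral>x. K x \<partial>M1) - (\<integral>x. K x \<partial>M2)))
      \<le> ennreal (norm (T1 M1 - T1 M2)) + ennreal (norm (T2 M1 - T2 M2)) + ennreal (norm (T12 M1 - T12 M2))"
    using ennreal_leI[OF tri] by simp
  also note add_mono[OF add_mono[OF d1 d2] d12]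
  finally show ?thesis
    unfolding k distrib_left .
qed

section \<open>Partial derivatives as limits of difference quotients\<close>

lemma has_vector_derivative_sequence:
  fixes f :: "real \<Rightarrow> 'a::real_normed_vector"
  assumes "(f has_vector_derivative d) (at x)"
  shows "(\<lambda>n. real (Suc n) *\<^sub>R (f (x + 1 / real (Suc n)) - f x)) \<longlonglongrightarrow> d"
proof -
  have "((\<lambda>h. (f (x + h) - f x) /\<^sub>R h) \<longlongrightarrow> d) (at 0)"
  proof (rule Lim_null_comparison[where g = "\<lambda>h. norm (f (x + h) - f x - h *\<^sub>R d) / norm h", THEN LIM_zero_cancel])
    have "(f (x + h) - f x) /\<^sub>R h - d = (f (x + h) - f x - h *\<^sub>R d) /\<^sub>R h" if "h \<noteq> 0" for h
      using that by (simp add: scaleR_diff_right)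
    then show "\<forall>\<^sub>F h in at 0. norm ((f (x + h) - f x) /\<^sub>R h - d) \<le> norm (f (x + h) - f x - h *\<^sub>R d) / norm h"
      by (auto simp: eventually_at_filter divide_inverse_commute)
    show "((\<lambda>h. norm (f (x + h) - f x - h *\<^sub>R d) / norm h) \<longlongrightarrow> 0) (at 0)"
      using assms unfolding has_vector_derivative_def has_derivative_at by blast
  qed
  moreover have "filterlim (\<lambda>n. 1 / real (Suc n)) (at 0) sequentially"
    by (intro filterlim_atI lim_1_over_n[THEN LIMSEQ_Suc]) auto
  ultimately have "((\<lambda>n. (f (x + 1 / real (Suc n)) - f x) /\<^sub>R (1 / real (Suc n))) \<longlonglongrightarrow> d)"
    by (rule filterlim_compose)
  then show ?thesis by simp
qed

text \<open>Upper limits of difference quotients stand in for the absolute values of the partial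
  derivatives: unlike those they are measurable jointly in all parameters without any
  differentiability assumption.\<close>

definition quot1 :: "nat \<Rightarrow> (real \<times> real \<Rightarrow> complex) \<Rightarrow> real \<times> real \<Rightarrow> complex" where
  "quot1 n K p = real (Suc n) *\<^sub>R (K (fst p + 1 / real (Suc n), snd p) - K p)"

definition quot2 :: "nat \<Rightarrow> (real \<times> real \<Rightarrow> complex) \<Rightarrow> real \<times> real \<Rightarrow> complex" where
  "quot2 n K p = real (Suc n) *\<^sub>R (K (fst p, snd p + 1 / real (Suc n)) - K p)"

definition upper1 :: "(real \<times> real \<Rightarrow> complex) \<Rightarrow> real \<times> real \<Rightarrow> ennreal" where
  "upper1 K p = limsup (\<lambda>n. ennreal (norm (quot1 n K p)))"

definition upper2 :: "(real \<times> real \<Rightarrow> complex) \<Rightarrow> real \<times> real \<Rightarrow> ennreal" where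
  "upper2 K p = limsup (\<lambda>n. ennreal (norm (quot2 n K p)))"

definition upper12 :: "(real \<times> real \<Rightarrow> complex) \<Rightarrow> real \<times> real \<Rightarrow> ennreal" where
  "upper12 K p = limsup (\<lambda>m. limsup (\<lambda>n. ennreal (norm (quot2 m (quot1 n K) p))))"

lemma upper_eq_partial:
  assumes "has_cont_mixed_partials K"
  shows "upper1 K p = ennreal (norm (partial1 K p))"
    and "upper2 K p = ennreal (norm (partial2 K p))"
    and "upper12 K p = ennreal (norm (partial12 K p))"
proof -
  have 1: "(\<lambda>n. quot1 n K q) \<longlonglongrightarrow> partial1 K q" for q
    using has_vector_derivative_sequence[OF has_cont_mixed_partialsD(4)[OF assms, of "snd q" "fst q"]]
    by (simp add: quot1_def)
  have 2: "(\<lambda>n. quot2 n K p) \<longlonglongrightarrow> partial2 K p"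
    using has_vector_derivative_sequence[OF has_cont_mixed_partialsD(5)[OF assms, of "fst p" "snd p"]]
    by (simp add: quot2_def)
  have 12: "(\<lambda>m. quot2 m (partial1 K) p) \<longlonglongrightarrow> partial12 K p"
    using has_vector_derivative_sequence[OF has_cont_mixed_partialsD(6)[OF assms, of "fst p" "snd p"]]
    by (simp add: quot2_def)
  show "upper1 K p = ennreal (norm (partial1 K p))"
    unfolding upper1_def by (intro lim_imp_Limsup tendsto_ennrealI tendsto_norm 1) simp
  show "upper2 K p = ennreal (norm (partial2 K p))"
    unfolding upper2_def by (intro lim_imp_Limsup tendsto_ennrealI tendsto_norm 2) simp
  \<comment> \<open>For fixed m the outer quotient involves just two values, so the inner limit
    passes through it.\<close>
  have "limsup (\<lambda>n. ennreal (norm (quot2 m (quot1 n K) p))) = ennreal (norm (quot2 m (partial1 K) p))" for m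
    unfolding quot2_def
    by (intro lim_imp_Limsup tendsto_ennrealI tendsto_norm tendsto_scaleR tendsto_diff tendsto_const 1) simp
  then show "upper12 K p = ennreal (norm (partial12 K p))"
    unfolding upper12_def by (simp add: lim_imp_Limsup tendsto_ennrealI tendsto_norm 12)
qed

lemma has_cont_mixed_partials_cnj:
  assumes "has_cont_mixed_partials K"
  shows "has_cont_mixed_partials (\<lambda>x. cnj (K x))"
proof -
  obtain D1 D2 D12 where "continuous_on UNIV D1" "continuous_on UNIV D2" "continuous_on UNIV D12"
    "\<And>x y. ((\<lambda>s. K (s, y)) has_vector_derivative D1 (x, y)) (at x)"
    "\<And>x y. ((\<lambda>t. K (x, t)) has_vector_derivative D2 (x, y)) (at y)"
    "\<And>x y. ((\<lambda>t. D1 (x, t)) has_vector_derivative D12 (x, y)) (at y)"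
    using assms unfolding has_cont_mixed_partials_def by blast
  then show ?thesis
    unfolding has_cont_mixed_partials_def
    by (intro exI[of _ "\<lambda>x. cnj (D1 x)"] exI[of _ "\<lambda>x. cnj (D2 x)"] exI[of _ "\<lambda>x. cnj (D12 x)"])
      (auto intro!: continuous_on_cnj has_vector_derivative_cnj)
qed

lemma upper_cnj:
  "upper1 (\<lambda>x. cnj (K x)) = upper1 K" "upper2 (\<lambda>x. cnj (K x)) = upper2 K"
  "upper12 (\<lambda>x. cnj (K x)) = upper12 K"
proof -
  have q: "quot1 n (\<lambda>x. cnj (K x)) = (\<lambda>x. cnj (quot1 n K x))" "quot2 n (\<lambda>x. cnj (K x)) = (\<lambda>x. cnj (quot2 n K x))" for n K
    by (auto simp: quot1_def quot2_def)
  show "upper1 (\<lambda>x. cnj (K x)) = upper1 K" "upper2 (\<lambda>x. cnj (K x)) = upper2 K"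
    "upper12 (\<lambda>x. cnj (K x)) = upper12 K"
    by (auto simp: upper1_def upper2_def upper12_def q)
qed

text \<open>The infimum of the almost-everywhere bounds is reached along a sequence of such bounds,
  and countably many null sets form a null set.\<close>

lemma AE_le_ess_sup: "AE x in M. g x \<le> ess_sup M g"
proof -
  have "top \<in> {c. AE x in M. g x \<le> c}" by simp
  then have "{c. AE x in M. g x \<le> c} \<noteq> {}" by blast
  from ennreal_Inf_countable_INF[OF this] obtain f :: "nat \<Rightarrow> ennreal"
    where f: "range f \<subseteq> {c. AE x in M. g x \<le> c}" "ess_sup M g = (INF i. f i)"
    unfolding ess_sup_def by auto
  then have "AE x in M. \<forall>i. g x \<le> f i"
    unfolding AE_all_countable by blast
  then show ?thesis
    by eventually_elim (auto simp: f(2) intro: INF_greatest)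
qed

section \<open>Discrepancy and Koksma-Hlawka on a translated square\<close>

lemma translated_box: "(\<lambda>x. (a, b) + x) ` cbox (0, 0) (s, t) = {a..a + s :: real} \<times> {b..b + t :: real}"
  using cbox_translation[of "(a, b)" "(0, 0)" "(s, t)"] by (simp add: cbox_Pair_eq)

lemma translated_unit_square: "(\<lambda>x. (a, b) + x) ` unit_square = {a..a + 1} \<times> {b..b + 1}"
  unfolding unit_square_def by (rule translated_box)

lemma unit_square_iff: "\<eta> \<in> unit_square \<longleftrightarrow> 0 \<le> fst \<eta> \<and> fst \<eta> \<le> 1 \<and> 0 \<le> snd \<eta> \<and> snd \<eta> \<le> 1"
  unfolding unit_square_def by (cases \<eta>) (auto simp: cbox_Pair_eq)

locale sampling_set =
  fixes \<Lambda> :: "(real \<times> real) set"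
  assumes discrete: "bounded B \<Longrightarrow> finite (\<Lambda> \<inter> B)"
    and count_pos: "count_N \<Lambda> \<rho> \<ge> 1"
begin

abbreviation "D \<equiv> shift_discrepancy \<Lambda>"

abbreviation local_discrepancy :: "real \<times> real \<Rightarrow> real \<times> real \<Rightarrow> real" where
  "local_discrepancy \<rho> \<eta> \<equiv> \<bar>real (card (\<Lambda> \<inter> ((\<lambda>x. \<rho> + x) ` cbox (0, 0) \<eta>))) / real (count_N \<Lambda> \<rho>)
        - fst \<eta> * snd \<eta>\<bar>"

lemma countable_points: "countable \<Lambda>"
proof -
  have "\<Lambda> \<subseteq> (\<Union>n. \<Lambda> \<inter> cball 0 (real n))"
  proof
    fix x assume "x \<in> \<Lambda>"
    moreover obtain n :: nat where "norm x \<le> real n" using real_arch_simple[of "norm x"] by blast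
    ultimately have "x \<in> \<Lambda> \<inter> cball 0 (real n)" by simp
    then show "x \<in> (\<Union>n. \<Lambda> \<inter> cball 0 (real n))" by (rule UN_I[OF UNIV_I])
  qed
  moreover have "countable (\<Union>n. \<Lambda> \<inter> cball 0 (real n))"
    by (intro countable_UN countableI_type) (auto intro!: countable_finite discrete)
  ultimately show ?thesis by (rule countable_subset)
qed

text \<open>The suprema in \<open>shift_discrepancy\<close> are taken in the reals and dominate
  their terms only when these are bounded. Here both the counting ratio and the area lie in
  [0,1].\<close>

lemma local_discrepancy_le_1:
  assumes "\<eta> \<in> unit_square"
  shows "local_discrepancy \<rho> \<eta> \<le> 1"
proof -
  have "card (\<Lambda> \<inter> ((\<lambda>x. \<rho> + x) ` cbox (0, 0) \<eta>)) \<le> count_N \<Lambda> \<rho>"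
    unfolding count_N_def
  proof (rule card_mono)
    show "finite (\<Lambda> \<inter> (\<lambda>x. \<rho> + x) ` unit_square)"
      using count_pos[of \<rho>] unfolding count_N_def by (metis card.infinite not_one_le_zero)
    show "\<Lambda> \<inter> (\<lambda>x. \<rho> + x) ` cbox (0, 0) \<eta> \<subseteq> \<Lambda> \<inter> (\<lambda>x. \<rho> + x) ` unit_square"
      using assms by (cases \<rho>, cases \<eta>) (fastforce simp: translated_box translated_unit_square unit_square_iff simp del: add_Pair)
  qed
  then have "real (card (\<Lambda> \<inter> ((\<lambda>x. \<rho> + x) ` cbox (0, 0) \<eta>))) / real (count_N \<Lambda> \<rho>) \<le> 1"
    using count_pos[of \<rho>] by (simp add: divide_simps)
  moreover have "0 \<le> real (card (\<Lambda> \<inter> ((\<lambda>x. \<rho> + x) ` cbox (0, 0) \<eta>))) / real (count_N \<Lambda> \<rho>)" by simp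
  moreover have "0 \<le> fst \<eta> * snd \<eta>" "fst \<eta> * snd \<eta> \<le> 1"
    using assms unfolding unit_square_iff by (auto intro: mult_le_one)
  ultimately show ?thesis by linarith
qed

lemma local_discrepancy_le:
  assumes "\<eta> \<in> unit_square"
  shows "local_discrepancy \<rho> \<eta> \<le> D"
proof -
  have "unit_square \<noteq> {}" using assms by auto
  have le1: "(SUP \<eta>\<in>unit_square. local_discrepancy \<rho> \<eta>) \<le> 1" for \<rho>
    using \<open>unit_square \<noteq> {}\<close> by (intro cSUP_least local_discrepancy_le_1)
  have "local_discrepancy \<rho> \<eta> \<le> (SUP \<eta>\<in>unit_square. local_discrepancy \<rho> \<eta>)"
    by (rule cSUP_upper[OF assms]) (auto intro!: bdd_aboveI[of _ 1] local_discrepancy_le_1)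
  also have "\<dots> \<le> D"
    unfolding shift_discrepancy_def
    by (rule cSUP_upper) (auto intro!: bdd_aboveI[of _ 1] le1)
  finally show ?thesis .
qed

text \<open>The degenerate box at a sample point has area 0 but contains that point. Positivity is
  used to conclude that \<open>Omega\<close> is finite: in \<open>ennreal\<close> the product of 0
  and infinity is 0, so with D = 0 the smallness condition would say nothing about
  \<open>Omega\<close>.\<close>

lemma discrepancy_pos: "D > 0"
proof -
  obtain l where l: "l \<in> \<Lambda>"
    using count_pos[of 0] unfolding count_N_def by (metis card.empty disjoint_iff not_one_le_zero)
  have "\<Lambda> \<inter> (\<lambda>x. l + x) ` cbox (0, 0) 0 = {l}"
    using l by (cases l) (auto simp: translated_box zero_prod_def)
  then have "local_discrepancy l 0 > 0"
    using count_pos[of l] by simp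
  also have "local_discrepancy l 0 \<le> D"
    by (rule local_discrepancy_le) (simp add: unit_square_iff)
  finally show ?thesis .
qed

text \<open>The two measures are the uniform probability measure on the sample points in Q and
  Lebesgue measure on Q. A box with corner (s, t) corresponds to the parameter (s - a, t - b) in the
  discrepancy. The bound is phrased with \<open>upper1\<close>, \<open>upper2\<close> and
  \<open>upper12\<close> so that it can later be integrated over the parameters of K.\<close>

lemma Koksma_Hlawka:
  fixes \<rho> :: "real \<times> real"
  assumes K: "has_cont_mixed_partials K"
  defines "Q \<equiv> (\<lambda>x. \<rho> + x) ` unit_square"
  shows "ennreal (norm ((\<Sum>l\<in>\<Lambda> \<inter> Q. K l) / real (count_N \<Lambda> \<rho>) - (\<integral>x. K x \<partial>restrict_space lborel Q))) \<le> ennreal D *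
     ((\<integral>\<^sup>+ s. upper1 K (s, snd \<rho> + 1) * indicator {fst \<rho>..fst \<rho> + 1} s \<partial>lborel)
    + (\<integral>\<^sup>+ t. upper2 K (fst \<rho> + 1, t) * indicator {snd \<rho>..snd \<rho> + 1} t \<partial>lborel)
    + (\<integral>\<^sup>+ p. upper12 K p * indicator Q p \<partial>lborel))"
proof -
  obtain a b where \<rho>: "\<rho> = (a, b)" by (cases \<rho>)
  define M1 where "M1 = uniform_count_measure (\<Lambda> \<inter> Q)"
  define M2 where "M2 = restrict_space lborel Q"
  have Q: "Q = {a..a+1} \<times> {b..b+1}"
    unfolding Q_def \<rho> translated_unit_square ..
  have Qb: "Q = cbox (a, b) (a + 1, b + 1)"
    unfolding Q by (simp add: cbox_Pair_eq)
  have Qs: "Q \<in> sets borel"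
    unfolding Qb by simp
  have card: "card (\<Lambda> \<inter> Q) = count_N \<Lambda> \<rho>" unfolding count_N_def Q_def ..
  then have ne: "card (\<Lambda> \<inter> Q) > 0"
    using count_pos[of \<rho>] by simp
  then have fin: "finite (\<Lambda> \<inter> Q)"
    by (rule card_ge_0_finite)
  have sp1: "space M1 = \<Lambda> \<inter> Q" by (simp add: M1_def space_uniform_count_measure)
  have sp2: "space M2 = Q" by (simp add: M2_def space_restrict_space)
  have content: "emeasure lborel ({a..a+s} \<times> {b..b+t}) = ennreal (s * t)" if "0 \<le> s" "0 \<le> t" for s t
    using that by (simp add: lborel_prod[symmetric] lborel.emeasure_pair_measure_Times ennreal_mult)
  have e1: "emeasure M1 (space M1) = 1"
    unfolding sp1 unfolding M1_def using fin ne by (subst emeasure_uniform_count_measure) auto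
  have e2: "emeasure M2 (space M2) = 1"
    unfolding sp2 unfolding M2_def using content[of 1 1] Qs by (subst emeasure_restrict_space) (auto simp: Q)
  have m1: "(\<lambda>x. x) \<in> measurable M1 borel"
    by (auto simp: M1_def measurable_def sets_uniform_count_measure space_uniform_count_measure)
  have m2: "(\<lambda>x. x) \<in> measurable M2 borel"
    unfolding M2_def by (intro measurable_restrict_space1) auto
  have disc: "\<bar>measure M1 {x \<in> space M1. fst x \<le> s \<and> snd x \<le> t}
        - measure M2 {x \<in> space M2. fst x \<le> s \<and> snd x \<le> t}\<bar> \<le> D" if st: "(s, t) \<in> {a..a+1} \<times> {b..b+1}" for s t
  proof -
    have \<eta>: "(s - a, t - b) \<in> unit_square" using st by (auto simp: unit_square_iff)
    have box: "(\<lambda>x. \<rho> + x) ` cbox (0, 0) (s - a, t - b) = {a..s} \<times> {b..t}"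
      using translated_box[of a b "s - a" "t - b"] \<rho> by simp
    have "{x \<in> space M1. fst x \<le> s \<and> snd x \<le> t} = \<Lambda> \<inter> {a..s} \<times> {b..t}"
      "{x \<in> space M2. fst x \<le> s \<and> snd x \<le> t} = {a..s} \<times> {b..t}"
      using st by (auto simp: sp1 sp2 Q)
    moreover have "measure M1 (\<Lambda> \<inter> {a..s} \<times> {b..t}) = card (\<Lambda> \<inter> {a..s} \<times> {b..t}) / count_N \<Lambda> \<rho>"
      unfolding M1_def using fin st card by (subst measure_uniform_count_measure) (auto simp: Q)
    moreover have "measure M2 ({a..s} \<times> {b..t}) = (s - a) * (t - b)"
      unfolding M2_def using content[of "s - a" "t - b"] st Qs
      by (subst measure_restrict_space) (auto simp: Q measure_def)
    ultimately show ?thesis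
      using local_discrepancy_le[OF \<eta>, of \<rho>] by (simp add: box)
  qed
  have i1: "(\<integral>x. K x \<partial>M1) = (\<Sum>l\<in>\<Lambda> \<inter> Q. K l) / real (count_N \<Lambda> \<rho>)"
    unfolding M1_def using fin
    by (simp add: uniform_count_measure_def lebesgue_integral_point_measure_finite card sum_divide_distrib
        scaleR_conv_of_real)
  have sub: "space M1 \<subseteq> {a..a+1} \<times> {b..b+1}" "space M2 \<subseteq> {a..a+1} \<times> {b..b+1}"
    unfolding sp1 sp2 Q by auto
  show ?thesis
    using Koksma_Hlawka_measures[OF K e1 m1 sub(1) e2 m2 sub(2) disc]
    by (simp add: upper_eq_partial[OF K] i1 M2_def Q[symmetric] \<rho>)
qed

end

subsection \<open>Schur's test\<close>

lemma measurable_fst_snd_borel [measurable]: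
  "fst \<in> borel_measurable (borel :: (real \<times> real) measure)"
  "snd \<in> borel_measurable (borel :: (real \<times> real) measure)"
  "(fst :: _ \<Rightarrow> real \<times> real) \<in> borel_measurable (borel :: ((real \<times> real) \<times> (real \<times> real)) measure)"
  "(snd :: _ \<Rightarrow> real \<times> real) \<in> borel_measurable (borel :: ((real \<times> real) \<times> (real \<times> real)) measure)"
  unfolding borel_prod[symmetric] by measurable

lemma nn_integral_lborel_Times:
  fixes f :: "'a::euclidean_space \<times> 'b::euclidean_space \<Rightarrow> ennreal"
  assumes "f \<in> borel_measurable borel"
  shows "(\<integral>\<^sup>+ p. f p \<partial>lborel) = (\<integral>\<^sup>+ x. (\<integral>\<^sup>+ y. f (x, y) \<partial>lborel) \<partial>lborel)"
    and "(\<integral>\<^sup>+ p. f p \<partial>lborel) = (\<integral>\<^sup>+ y. (\<integral>\<^sup>+ x. f (x, y) \<partial>lborel) \<partial>lborel)"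
proof -
  have "f \<in> borel_measurable (lborel \<Otimes>\<^sub>M lborel)"
    using assms by (simp add: lborel_prod)
  from lborel.nn_integral_fst[OF this] lborel_pair.nn_integral_snd[OF this]
  show "(\<integral>\<^sup>+ p. f p \<partial>lborel) = (\<integral>\<^sup>+ x. (\<integral>\<^sup>+ y. f (x, y) \<partial>lborel) \<partial>lborel)"
    "(\<integral>\<^sup>+ p. f p \<partial>lborel) = (\<integral>\<^sup>+ y. (\<integral>\<^sup>+ x. f (x, y) \<partial>lborel) \<partial>lborel)"
    by (simp_all add: lborel_prod)
qed

lemma mem_translated_unit_square:
  "l \<in> (\<lambda>x. \<rho> + x) ` unit_square
    \<longleftrightarrow> fst \<rho> \<le> fst l \<and> fst l \<le> fst \<rho> + 1 \<and> snd \<rho> \<le> snd l \<and> snd l \<le> snd \<rho> + 1"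
proof -
  obtain a b where "\<rho> = (a, b)" by (cases \<rho>)
  then show ?thesis unfolding translated_unit_square by (cases l) (auto simp: translated_unit_square)
qed

text \<open>Through an enumeration of the sample points the count becomes the cardinality of a
  random set of natural numbers, and membership of each index is a measurable condition on the
  position of the square.\<close>

lemma (in sampling_set) measurable_count [measurable]:
  "(\<lambda>\<rho>. real (count_N \<Lambda> \<rho>)) \<in> borel_measurable borel"
proof -
  have *: "count_N \<Lambda> \<rho> = card {i. \<exists>l\<in>\<Lambda>. i = to_nat_on \<Lambda> l \<and> l \<in> (\<lambda>x. \<rho> + x) ` unit_square}" for \<rho>
  proof -
    have "inj_on (to_nat_on \<Lambda>) (\<Lambda> \<inter> (\<lambda>x. \<rho> + x) ` unit_square)"
      by (rule inj_on_subset[OF inj_on_to_nat_on[OF countable_points]]) auto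
    moreover have "to_nat_on \<Lambda> ` (\<Lambda> \<inter> (\<lambda>x. \<rho> + x) ` unit_square)
        = {i. \<exists>l\<in>\<Lambda>. i = to_nat_on \<Lambda> l \<and> l \<in> (\<lambda>x. \<rho> + x) ` unit_square}"
      by blast
    ultimately show ?thesis
      unfolding count_N_def by (metis card_image)
  qed
  have "(\<lambda>\<rho>. count_N \<Lambda> \<rho>) \<in> measurable borel (count_space UNIV)"
    unfolding * mem_translated_unit_square mem_Collect_eq
    by (intro measurable_card) (use countable_points in measurable)
  then show ?thesis by measurable
qed

context parseval_frame
begin

lemma measurable_frame_K [measurable]:
  assumes [measurable]: "f \<in> measurable M borel" "g \<in> measurable M borel" "h \<in> measurable M borel"
  shows "(\<lambda>\<omega>. frame_K \<psi> (f \<omega>) (g \<omega>) (h \<omega>)) \<in> borel_measurable M"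
  unfolding frame_K_def frame_R_def by measurable

lemma measurable_upper [measurable]:
  assumes [measurable]: "f \<in> measurable M borel" "g \<in> measurable M borel" "h \<in> measurable M borel"
  shows "(\<lambda>\<omega>. upper1 (frame_K \<psi> (f \<omega>) (g \<omega>)) (h \<omega>)) \<in> borel_measurable M"
    and "(\<lambda>\<omega>. upper2 (frame_K \<psi> (f \<omega>) (g \<omega>)) (h \<omega>)) \<in> borel_measurable M"
    and "(\<lambda>\<omega>. upper12 (frame_K \<psi> (f \<omega>) (g \<omega>)) (h \<omega>)) \<in> borel_measurable M"
proof -
  have [measurable]: "(\<lambda>\<omega>. fst (h \<omega>)) \<in> borel_measurable M" "(\<lambda>\<omega>. snd (h \<omega>)) \<in> borel_measurable M"
    by (rule measurable_compose[OF assms(3)], measurable)+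
  show "(\<lambda>\<omega>. upper1 (frame_K \<psi> (f \<omega>) (g \<omega>)) (h \<omega>)) \<in> borel_measurable M"
    "(\<lambda>\<omega>. upper2 (frame_K \<psi> (f \<omega>) (g \<omega>)) (h \<omega>)) \<in> borel_measurable M"
    "(\<lambda>\<omega>. upper12 (frame_K \<psi> (f \<omega>) (g \<omega>)) (h \<omega>)) \<in> borel_measurable M"
    unfolding upper1_def upper2_def upper12_def quot1_def quot2_def fst_conv snd_conv by measurable
qed

lemma frame_K_swap: "frame_K \<psi> \<nu> \<eta> = (\<lambda>\<rho>. cnj (frame_K \<psi> \<eta> \<nu> \<rho>))"
  unfolding frame_K_def frame_R_def
  by (rule ext) (metis complex_cnj_mult hinner_conj mult.commute)

text \<open>The bracket in the definition of \<open>Omega\<close>, with the upper limits in place of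
  the derivatives so that it is measurable in both variables; it is the kernel for Schur's
  test.\<close>

definition weight :: "real \<times> real \<Rightarrow> real \<times> real \<Rightarrow> ennreal" where
  "weight \<eta> \<nu> = (\<integral>\<^sup>+ x. upper1 (frame_K \<psi> \<eta> \<nu>) x + upper2 (frame_K \<psi> \<eta> \<nu>) x
     + upper12 (frame_K \<psi> \<eta> \<nu>) x \<partial>lborel)"

lemma measurable_weight [measurable]:
  assumes [measurable]: "f \<in> measurable M borel" "g \<in> measurable M borel"
  shows "(\<lambda>\<omega>. weight (f \<omega>) (g \<omega>)) \<in> borel_measurable M"
  unfolding weight_def by measurable

text \<open>Swapping the parameters conjugates the kernel and leaves absolute values of difference
  quotients unchanged. Hence \<open>Omega\<close>, which bounds the integral over only one variable,
  bounds the other marginal as well.\<close>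

lemma weight_sym: "weight \<eta> \<nu> = weight \<nu> \<eta>"
  unfolding weight_def frame_K_swap[of \<nu> \<eta>] upper_cnj ..

end

locale smooth_parseval_frame = parseval_frame \<psi> for \<psi> :: "real \<times> real \<Rightarrow> 'a::complex_hilbert" +
  assumes smooth: "AE p in (lborel :: ((real \<times> real) \<times> (real \<times> real)) measure).
      has_cont_mixed_partials (frame_K \<psi> (fst p) (snd p))"
begin

lemma AE_weight_integral_le_Omega: "AE \<nu> in lborel. (\<integral>\<^sup>+ \<eta>. weight \<eta> \<nu> \<partial>lborel) \<le> Omega \<psi>"
proof -
  have "AE \<nu> in lborel. AE \<eta> in lborel. has_cont_mixed_partials (frame_K \<psi> \<nu> \<eta>)"
    using lborel_pair.AE_pair[unfolded lborel_prod, OF smooth] by simp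
  moreover have "AE \<nu> in lborel. (\<integral>\<^sup>+ \<eta>. L1norm (partial1 (frame_K \<psi> \<eta> \<nu>)) + L1norm (partial2 (frame_K \<psi> \<eta> \<nu>))
      + L1norm (partial12 (frame_K \<psi> \<eta> \<nu>)) \<partial>lborel) \<le> Omega \<psi>"
    unfolding Omega_def by (rule AE_le_ess_sup)
  ultimately show ?thesis
  proof eventually_elim
    case (elim \<nu>)
    have "(\<integral>\<^sup>+ \<eta>. weight \<eta> \<nu> \<partial>lborel) = (\<integral>\<^sup>+ \<eta>. L1norm (partial1 (frame_K \<psi> \<eta> \<nu>))
        + L1norm (partial2 (frame_K \<psi> \<eta> \<nu>)) + L1norm (partial12 (frame_K \<psi> \<eta> \<nu>)) \<partial>lborel)"
    proof (rule nn_integral_cong_AE, use elim(1) in eventually_elim)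
      fix \<eta> assume "has_cont_mixed_partials (frame_K \<psi> \<nu> \<eta>)"
      \<comment> \<open>Slicing the smoothness assumption at its first coordinate yields the kernel
        with parameters in the opposite order; conjugation restores the order used in
        \<open>Omega\<close>.\<close>
      then have h: "has_cont_mixed_partials (frame_K \<psi> \<eta> \<nu>)"
        unfolding frame_K_swap[of \<eta> \<nu>] by (rule has_cont_mixed_partials_cnj)
      then show "weight \<eta> \<nu> = L1norm (partial1 (frame_K \<psi> \<eta> \<nu>))
        + L1norm (partial2 (frame_K \<psi> \<eta> \<nu>)) + L1norm (partial12 (frame_K \<psi> \<eta> \<nu>))"
        unfolding weight_def L1norm_def
        by (subst nn_integral_add, measurable, subst nn_integral_add, measurable)
          (simp add: upper_eq_partial[OF h, abs_def])
    qed
    with elim(2) show ?case by simp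
  qed
qed

text \<open>The product of the two values of |G| is at most half the sum of their squares. Each half
  contains one variable only, so the other can be integrated out against the weight, at a cost of at
  most \<open>Omega\<close>.\<close>

lemma Schur_test:
  assumes [measurable]: "G \<in> borel_measurable borel"
  shows "(\<integral>\<^sup>+ p. ennreal (cmod (G (snd p)) * cmod (G (fst p))) * weight (fst p) (snd p) \<partial>lborel)
     \<le> Omega \<psi> * (\<integral>\<^sup>+ x. ennreal ((cmod (G x))\<^sup>2) \<partial>lborel)"
proof -
  let ?g = "\<lambda>x. ennreal ((cmod (G x))\<^sup>2 / 2)"
  have half: "(\<integral>\<^sup>+ \<nu>. (\<integral>\<^sup>+ \<eta>. ?g \<nu> * weight \<eta> \<nu> \<partial>lborel) \<partial>lborel) \<le> Omega \<psi> * (\<integral>\<^sup>+ x. ?g x \<partial>lborel)"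
  proof -
    have "(\<integral>\<^sup>+ \<nu>. (\<integral>\<^sup>+ \<eta>. ?g \<nu> * weight \<eta> \<nu> \<partial>lborel) \<partial>lborel)
       = (\<integral>\<^sup>+ \<nu>. (\<integral>\<^sup>+ \<eta>. weight \<eta> \<nu> \<partial>lborel) * ?g \<nu> \<partial>lborel)"
      by (simp add: nn_integral_multc mult.commute[of "ennreal _" "weight _ _"])
    also have "\<dots> \<le> (\<integral>\<^sup>+ \<nu>. Omega \<psi> * ?g \<nu> \<partial>lborel)"
      by (rule nn_integral_mono_AE, use AE_weight_integral_le_Omega in eventually_elim) (rule mult_right_mono, auto)
    also have "\<dots> = Omega \<psi> * (\<integral>\<^sup>+ x. ?g x \<partial>lborel)"
      by (rule nn_integral_cmult) measurable
    finally show ?thesis .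
  qed
  have "ennreal (cmod (G (snd p)) * cmod (G (fst p))) * weight (fst p) (snd p)
      \<le> ?g (snd p) * weight (fst p) (snd p) + ?g (fst p) * weight (snd p) (fst p)" for p
  proof -
    have "cmod (G (snd p)) * cmod (G (fst p)) \<le> (cmod (G (snd p)))\<^sup>2 / 2 + (cmod (G (fst p)))\<^sup>2 / 2"
      using sum_squares_bound[of "cmod (G (snd p))" "cmod (G (fst p))"] by simp
    from ennreal_leI[OF this] have "ennreal (cmod (G (snd p)) * cmod (G (fst p))) \<le> ?g (snd p) + ?g (fst p)"
      by simp
    then show ?thesis
      unfolding weight_sym[of "snd p"] distrib_right[symmetric] by (rule mult_right_mono) simp
  qed
  then have "(\<integral>\<^sup>+ p. ennreal (cmod (G (snd p)) * cmod (G (fst p))) * weight (fst p) (snd p) \<partial>lborel)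
    \<le> (\<integral>\<^sup>+ p. ?g (snd p) * weight (fst p) (snd p) + ?g (fst p) * weight (snd p) (fst p) \<partial>lborel)"
    by (rule nn_integral_mono)
  also have "\<dots> = (\<integral>\<^sup>+ p. ?g (snd p) * weight (fst p) (snd p) \<partial>lborel) + (\<integral>\<^sup>+ p. ?g (fst p) * weight (snd p) (fst p) \<partial>lborel)"
    by (rule nn_integral_add) measurable
  also have "(\<integral>\<^sup>+ p. ?g (fst p) * weight (snd p) (fst p) \<partial>lborel) = (\<integral>\<^sup>+ \<nu>. (\<integral>\<^sup>+ \<eta>. ?g \<nu> * weight \<eta> \<nu> \<partial>lborel) \<partial>lborel)"
    by (subst nn_integral_lborel_Times(1)) auto
  also have "(\<integral>\<^sup>+ p. ?g (snd p) * weight (fst p) (snd p) \<partial>lborel) = (\<integral>\<^sup>+ \<nu>. (\<integral>\<^sup>+ \<eta>. ?g \<nu> * weight \<eta> \<nu> \<partial>lborel) \<partial>lborel)"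
    by (subst nn_integral_lborel_Times(2)) auto
  also have "\<dots> + \<dots> \<le> Omega \<psi> * (\<integral>\<^sup>+ x. ?g x \<partial>lborel) + Omega \<psi> * (\<integral>\<^sup>+ x. ?g x \<partial>lborel)"
    by (rule add_mono half)+
  also have "\<dots> = Omega \<psi> * (\<integral>\<^sup>+ x. ?g x + ?g x \<partial>lborel)"
    by (subst nn_integral_add) (auto simp: distrib_left)
  also have "(\<integral>\<^sup>+ x. ?g x + ?g x \<partial>lborel) = (\<integral>\<^sup>+ x. ennreal ((cmod (G x))\<^sup>2) \<partial>lborel)"
    by (rule nn_integral_cong) (simp flip: ennreal_plus)
  finally show ?thesis .
qed

end

subsection \<open>Synthesis from truncated coefficients\<close>

lemma integrable_lborel_product:
  fixes f g :: "'a::euclidean_space \<Rightarrow> complex"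
  assumes f: "integrable lborel f" and g: "integrable lborel g"
  shows "integrable lborel (\<lambda>p. f (snd p) * g (fst p))"
    and "(\<integral>p. f (snd p) * g (fst p) \<partial>lborel) = integral\<^sup>L lborel f * integral\<^sup>L lborel g"
proof -
  have [measurable]: "f \<in> borel_measurable lborel" "g \<in> borel_measurable lborel"
    using f g by auto
  have I: "integrable (lborel \<Otimes>\<^sub>M lborel) (\<lambda>p. f (snd p) * g (fst p))"
    by (rule lborel_pair.Fubini_integrable) (use f g in \<open>auto simp: norm_mult\<close>)
  show "integrable lborel (\<lambda>p. f (snd p) * g (fst p))"
    using I by (simp add: lborel_prod)
  show "(\<integral>p. f (snd p) * g (fst p) \<partial>lborel) = integral\<^sup>L lborel f * integral\<^sup>L lborel g"
    using lborel_pair.integral_fst'[OF I] by (simp add: lborel_prod)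
qed

lemma integrable_bounded_support:
  fixes h :: "'a::euclidean_space \<Rightarrow> 'b::{banach, second_countable_topology}"
  assumes [measurable]: "h \<in> borel_measurable borel"
    and h: "\<And>x. h x \<noteq> 0 \<Longrightarrow> norm x \<le> r \<and> norm (h x) \<le> c"
  shows "integrable lborel h"
proof (rule Bochner_Integration.integrable_bound)
  show "integrable lborel (\<lambda>x. indicator (cball 0 r :: 'a set) x * \<bar>c\<bar>)"
    by (intro integrable_mult_left integrable_real_indicator emeasure_compact_finite) auto
  have "norm (h x) \<le> norm (indicator (cball 0 r) x * \<bar>c\<bar>)" for x
    using h[of x] by (cases "h x = 0") (auto split: split_indicator)
  then show "AE x in lborel. norm (h x) \<le> norm (indicator (cball 0 r) x * \<bar>c\<bar>)" by simp
qed measurable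

context parseval_frame
begin

text \<open>Formally the frame coefficients of the vector obtained by integrating G times the frame.
  On coefficient functions it is the identity, by the reproducing formula.\<close>

definition synth :: "(real \<times> real \<Rightarrow> complex) \<Rightarrow> real \<times> real \<Rightarrow> complex" where
  "synth G x = (\<integral>\<nu>. G \<nu> * hinner (\<psi> \<nu>) (\<psi> x) \<partial>lborel)"

text \<open>A single n bounds the support, the frame vectors over the support and the values. This
  is what makes all later interchanges absolutely convergent.\<close>

definition nice :: "(real \<times> real \<Rightarrow> complex) \<Rightarrow> bool" where
  "nice G \<longleftrightarrow> G \<in> borel_measurable borel \<and>
     (\<exists>n::nat. \<forall>\<nu>. G \<nu> \<noteq> 0 \<longrightarrow> norm \<nu> \<le> n \<and> norm (\<psi> \<nu>) \<le> n \<and> cmod (G \<nu>) \<le> n)"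

text \<open>The integrand of the squared modulus of \<open>synth G x\<close> as a double integral.
  Throughout, the first component of p is \<open>\<eta>\<close> and the second is
  \<open>\<nu>\<close>.\<close>

definition kern :: "(real \<times> real \<Rightarrow> complex) \<Rightarrow> (real \<times> real) \<times> (real \<times> real) \<Rightarrow> real \<times> real \<Rightarrow> complex" where
  "kern G p x = G (snd p) * cnj (G (fst p)) * frame_K \<psi> (fst p) (snd p) x"

lemma measurable_cnj [measurable (raw)]:
  "f \<in> borel_measurable M \<Longrightarrow> (\<lambda>x. cnj (f x)) \<in> borel_measurable M"
  by (rule measurable_compose[OF _ borel_measurable_continuous_onI]) (auto intro: continuous_intros)

lemma measurable_kern [measurable]:
  assumes [measurable]: "G \<in> borel_measurable borel" "f \<in> measurable M borel" "h \<in> measurable M borel"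
  shows "(\<lambda>\<omega>. kern G (f \<omega>) (h \<omega>)) \<in> borel_measurable M"
proof -
  have [measurable]: "(\<lambda>\<omega>. fst (f \<omega>)) \<in> measurable M borel" "(\<lambda>\<omega>. snd (f \<omega>)) \<in> measurable M borel"
    by (rule measurable_compose[OF assms(2)], measurable)+
  show ?thesis unfolding kern_def by measurable
qed

lemma kern_eq_product:
  "kern G p x = (G (snd p) * hinner (\<psi> (snd p)) (\<psi> x)) * cnj (G (fst p) * hinner (\<psi> (fst p)) (\<psi> x))"
  unfolding kern_def frame_K_def frame_R_def
  by (simp add: hinner_conj[symmetric] mult_ac)

lemma nice_integrable:
  assumes "nice G"
  shows "integrable lborel G" and "integrable lborel (\<lambda>x. (cmod (G x))\<^sup>2)"
    and "integrable lborel (\<lambda>\<nu>. G \<nu> * hinner (\<psi> \<nu>) (\<psi> x))"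
proof -
  obtain n :: nat where [measurable]: "G \<in> borel_measurable borel"
    and n: "\<And>\<nu>. G \<nu> \<noteq> 0 \<Longrightarrow> norm \<nu> \<le> n \<and> norm (\<psi> \<nu>) \<le> n \<and> cmod (G \<nu>) \<le> n"
    using assms unfolding nice_def by blast
  show "integrable lborel G"
    by (rule integrable_bounded_support[of _ n n]) (use n in auto)
  have "(cmod (G \<nu>))\<^sup>2 \<le> (real n)\<^sup>2" if "G \<nu> \<noteq> 0" for \<nu>
    using n[OF that] by (intro power_mono) auto
  then show "integrable lborel (\<lambda>x. (cmod (G x))\<^sup>2)"
    by (intro integrable_bounded_support[of _ n "(real n)\<^sup>2"]) (use n in auto)
  have "cmod (G \<nu> * hinner (\<psi> \<nu>) (\<psi> x)) \<le> n * (n * norm (\<psi> x))" if "G \<nu> \<noteq> 0" for \<nu>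
  proof -
    have "cmod (hinner (\<psi> \<nu>) (\<psi> x)) \<le> n * norm (\<psi> x)"
      using hinner_Cauchy_Schwarz[of "\<psi> \<nu>" "\<psi> x"] mult_right_mono[of "norm (\<psi> \<nu>)" n "norm (\<psi> x)"] n[OF that] norm_ge_zero[of "\<psi> x"]
      by force
    then show ?thesis
      using n[OF that] unfolding norm_mult by (intro mult_mono) auto
  qed
  then show "integrable lborel (\<lambda>\<nu>. G \<nu> * hinner (\<psi> \<nu>) (\<psi> x))"
    by (intro integrable_bounded_support[of _ n "n * (n * norm (\<psi> x))"]) (use n in auto)
qed

lemma measurable_synth [measurable]:
  assumes [measurable]: "G \<in> borel_measurable borel"
  shows "synth G \<in> borel_measurable borel"
  unfolding synth_def[abs_def] by measurable

lemma integral_kern: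
  assumes "nice G"
  shows "integrable lborel (\<lambda>p. kern G p x)"
    and "(\<integral>p. kern G p x \<partial>lborel) = complex_of_real ((cmod (synth G x))\<^sup>2)"
proof -
  note I = nice_integrable(3)[OF assms, of x]
  note J = integrable_lborel_product[OF I integrable_cnj[OF I]]
  show "integrable lborel (\<lambda>p. kern G p x)"
    unfolding kern_eq_product by (rule J(1))
  show "(\<integral>p. kern G p x \<partial>lborel) = complex_of_real ((cmod (synth G x))\<^sup>2)"
    unfolding kern_eq_product J(2) unfolding Bochner_Integration.integral_cnj synth_def complex_norm_square ..
qed

text \<open>For fixed p the product of the two inner products is at most the sum of their squares,
  and Parseval integrates these over x to squared norms of two frame vectors. On the support of G
  both norms are at most n; the remaining factor is integrable because G is.\<close>

lemma kern_total_finite: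
  assumes "nice G"
  shows "(\<integral>\<^sup>+ x. (\<integral>\<^sup>+ p. ennreal (cmod (kern G p x)) \<partial>lborel) \<partial>lborel) < \<infinity>"
proof -
  obtain n :: nat where [measurable]: "G \<in> borel_measurable borel"
    and n: "\<And>\<nu>. G \<nu> \<noteq> 0 \<Longrightarrow> norm \<nu> \<le> n \<and> norm (\<psi> \<nu>) \<le> n \<and> cmod (G \<nu>) \<le> n"
    using assms unfolding nice_def by blast
  note I = nice_integrable(1)[OF assms]
  have "(\<integral>\<^sup>+ x. (\<integral>\<^sup>+ p. ennreal (cmod (kern G p x)) \<partial>lborel) \<partial>lborel)
      = (\<integral>\<^sup>+ p. (\<integral>\<^sup>+ x. ennreal (cmod (kern G p x)) \<partial>lborel) \<partial>lborel)"
    by (rule lborel_pair.Fubini') measurable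
  also have "\<dots> \<le> (\<integral>\<^sup>+ p. ennreal (2 * (real n)\<^sup>2) * ennreal (cmod (G (snd p) * G (fst p))) \<partial>lborel)"
  proof (rule nn_integral_mono)
    fix p :: "(real \<times> real) \<times> (real \<times> real)"
    let ?u = "\<lambda>x. cmod (hinner (\<psi> (snd p)) (\<psi> x))" and ?v = "\<lambda>x. cmod (hinner (\<psi> (fst p)) (\<psi> x))"
    show "(\<integral>\<^sup>+ x. ennreal (cmod (kern G p x)) \<partial>lborel)
        \<le> ennreal (2 * (real n)\<^sup>2) * ennreal (cmod (G (snd p) * G (fst p)))"
    proof (cases "G (snd p) = 0 \<or> G (fst p) = 0")
      case False
      have "ennreal (cmod (kern G p x)) \<le> ennreal (cmod (G (snd p) * G (fst p))) * (ennreal ((?u x)\<^sup>2) + ennreal ((?v x)\<^sup>2))" for x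
      proof -
        have "?u x * ?v x \<le> (?u x)\<^sup>2 + (?v x)\<^sup>2"
          using sum_squares_bound[of "?u x" "?v x"]
              mult_nonneg_nonneg[OF norm_ge_zero norm_ge_zero, of "hinner (\<psi> (snd p)) (\<psi> x)" "hinner (\<psi> (fst p)) (\<psi> x)"]
            by linarith
        then have "cmod (kern G p x) \<le> cmod (G (snd p) * G (fst p)) * ((?u x)\<^sup>2 + (?v x)\<^sup>2)"
          using mult_left_mono[of "?u x * ?v x" "(?u x)\<^sup>2 + (?v x)\<^sup>2" "cmod (G (snd p) * G (fst p))"]
          by (simp add: kern_eq_product norm_mult mult_ac)
        from ennreal_leI[OF this] show ?thesis
          by (simp add: ennreal_mult)
      qed
      then have "(\<integral>\<^sup>+ x. ennreal (cmod (kern G p x)) \<partial>lborel)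
        \<le> (\<integral>\<^sup>+ x. ennreal (cmod (G (snd p) * G (fst p))) * (ennreal ((?u x)\<^sup>2) + ennreal ((?v x)\<^sup>2)) \<partial>lborel)"
        by (rule nn_integral_mono)
      also have "\<dots> = ennreal (cmod (G (snd p) * G (fst p))) * (ennreal ((norm (\<psi> (snd p)))\<^sup>2) + ennreal ((norm (\<psi> (fst p)))\<^sup>2))"
        by (simp add: nn_integral_cmult nn_integral_add parseval_nn)
      also have "\<dots> \<le> ennreal (cmod (G (snd p) * G (fst p))) * (ennreal ((real n)\<^sup>2) + ennreal ((real n)\<^sup>2))"
        using n False by (intro mult_left_mono add_mono ennreal_leI power_mono) auto
      also have "\<dots> = ennreal (2 * (real n)\<^sup>2) * ennreal (cmod (G (snd p) * G (fst p)))"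
        by (simp add: mult.commute flip: ennreal_plus)
      finally show ?thesis .
    qed (auto simp: kern_def)
  qed
  also have "\<dots> = ennreal (2 * (real n)\<^sup>2) * (\<integral>\<^sup>+ p. ennreal (cmod (G (snd p) * G (fst p))) \<partial>lborel)"
    by (rule nn_integral_cmult) measurable
  also have "\<dots> < \<infinity>"
    using integrable_lborel_product(1)[OF I I] unfolding integrable_iff_bounded
    by (simp add: ennreal_mult_less_top)
  finally show ?thesis .
qed

text \<open>The measure M is kept general because the formula is applied both on the whole plane and
  on a single square.\<close>

lemma synth_Fubini:
  assumes "nice G" and M: "sigma_finite_measure M" and m: "(\<lambda>x. x) \<in> measurable M borel"
    and fin: "(\<integral>\<^sup>+ x. (\<integral>\<^sup>+ p. ennreal (cmod (kern G p x)) \<partial>lborel) \<partial>M) < \<infinity>"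
  shows "integrable M (\<lambda>x. (cmod (synth G x))\<^sup>2)"
    and "integrable lborel (\<lambda>p. G (snd p) * cnj (G (fst p)) * (\<integral>x. frame_K \<psi> (fst p) (snd p) x \<partial>M))"
    and "complex_of_real (\<integral>x. (cmod (synth G x))\<^sup>2 \<partial>M)
      = (\<integral>p. G (snd p) * cnj (G (fst p)) * (\<integral>x. frame_K \<psi> (fst p) (snd p) x \<partial>M) \<partial>lborel)"
proof -
  have [measurable]: "G \<in> borel_measurable borel" using assms(1) by (simp add: nice_def)
  note [measurable] = m
  interpret M: sigma_finite_measure M by fact
  interpret P: pair_sigma_finite M "lborel :: ((real \<times> real) \<times> (real \<times> real)) measure" ..
  have [measurable]: "(\<lambda>z. fst z) \<in> measurable (M \<Otimes>\<^sub>M lborel) borel"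
    by (rule measurable_compose[OF measurable_fst m])
  have I: "integrable (M \<Otimes>\<^sub>M lborel) (\<lambda>(x, p). kern G p x)"
  proof (rule integrableI_bounded)
    show *: "(\<lambda>(x, p). kern G p x) \<in> borel_measurable (M \<Otimes>\<^sub>M lborel)"
      unfolding split_beta by measurable
    show "(\<integral>\<^sup>+ z. ennreal (norm (case z of (x, p) \<Rightarrow> kern G p x)) \<partial>(M \<Otimes>\<^sub>M lborel)) < \<infinity>"
      using fin by (subst lborel.nn_integral_fst[symmetric]) (use * in \<open>auto\<close>)
  qed
  have K: "(\<integral>x. kern G p x \<partial>M) = G (snd p) * cnj (G (fst p)) * (\<integral>x. frame_K \<psi> (fst p) (snd p) x \<partial>M)" for p
    unfolding kern_def by simp
  have "integrable M (\<lambda>x. Re (\<integral>p. kern G p x \<partial>lborel))"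
    by (rule integrable_Re) (rule P.integrable_fst[OF I])
  then show "integrable M (\<lambda>x. (cmod (synth G x))\<^sup>2)"
    unfolding integral_kern(2)[OF assms(1)] by simp
  show "integrable lborel (\<lambda>p. G (snd p) * cnj (G (fst p)) * (\<integral>x. frame_K \<psi> (fst p) (snd p) x \<partial>M))"
    using P.integrable_snd[OF I] unfolding K .
  have "complex_of_real (\<integral>x. (cmod (synth G x))\<^sup>2 \<partial>M) = (\<integral>x. (\<integral>p. kern G p x \<partial>lborel) \<partial>M)"
    unfolding integral_kern(2)[OF assms(1)] by (rule integral_complex_of_real[symmetric])
  also have "\<dots> = (\<integral>p. (\<integral>x. kern G p x \<partial>M) \<partial>lborel)"
    by (rule P.Fubini_integral[OF I, symmetric])
  finally show "complex_of_real (\<integral>x. (cmod (synth G x))\<^sup>2 \<partial>M)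
      = (\<integral>p. G (snd p) * cnj (G (fst p)) * (\<integral>x. frame_K \<psi> (fst p) (snd p) x \<partial>M) \<partial>lborel)"
    unfolding K .
qed

lemma synth_Fubini_lborel:
  assumes "nice G"
  shows "integrable lborel (\<lambda>x. (cmod (synth G x))\<^sup>2)"
    and "integrable lborel (\<lambda>p. G (snd p) * cnj (G (fst p)) * hinner (\<psi> (snd p)) (\<psi> (fst p)))"
    and "complex_of_real (\<integral>x. (cmod (synth G x))\<^sup>2 \<partial>lborel)
      = (\<integral>p. G (snd p) * cnj (G (fst p)) * hinner (\<psi> (snd p)) (\<psi> (fst p)) \<partial>lborel)"
proof -
  have "(\<integral>x. frame_K \<psi> \<eta> \<nu> x \<partial>lborel) = hinner (\<psi> \<nu>) (\<psi> \<eta>)" for \<eta> \<nu>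
    unfolding frame_K_def frame_R_def by (subst mult.commute) (rule reproducing)
  with synth_Fubini[OF assms lborel.sigma_finite_measure_axioms _ kern_total_finite[OF assms]]
  show "integrable lborel (\<lambda>x. (cmod (synth G x))\<^sup>2)"
    "integrable lborel (\<lambda>p. G (snd p) * cnj (G (fst p)) * hinner (\<psi> (snd p)) (\<psi> (fst p)))"
    "complex_of_real (\<integral>x. (cmod (synth G x))\<^sup>2 \<partial>lborel)
      = (\<integral>p. G (snd p) * cnj (G (fst p)) * hinner (\<psi> (snd p)) (\<psi> (fst p)) \<partial>lborel)"
    by simp_all
qed

text \<open>\<open>synth\<close> is an orthogonal projection, so \<open>\<parallel>synth G\<parallel>\<^sup>2 = \<langle>synth G, G\<rangle>\<close>.\<close>

lemma synth_contraction:
  assumes "nice G"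
  shows "(\<integral>\<^sup>+ x. ennreal ((cmod (synth G x))\<^sup>2) \<partial>lborel) \<le> (\<integral>\<^sup>+ x. ennreal ((cmod (G x))\<^sup>2) \<partial>lborel)"
proof -
  have [measurable]: "G \<in> borel_measurable borel" using assms by (simp add: nice_def)
  note I = synth_Fubini_lborel[OF assms] and J = nice_integrable[OF assms]
  let ?s = "\<integral>x. (cmod (synth G x))\<^sup>2 \<partial>lborel" and ?g = "\<integral>x. (cmod (G x))\<^sup>2 \<partial>lborel"
  have eq: "complex_of_real ?s = (\<integral>\<eta>. cnj (G \<eta>) * synth G \<eta> \<partial>lborel)"
  proof -
    have "complex_of_real ?s = (\<integral>\<eta>. (\<integral>\<nu>. G \<nu> * cnj (G \<eta>) * hinner (\<psi> \<nu>) (\<psi> \<eta>) \<partial>lborel) \<partial>lborel)"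
      using lborel_pair.integral_fst'[unfolded lborel_prod, OF I(2)] I(3) by simp
    also have "\<dots> = (\<integral>\<eta>. (\<integral>\<nu>. cnj (G \<eta>) * (G \<nu> * hinner (\<psi> \<nu>) (\<psi> \<eta>)) \<partial>lborel) \<partial>lborel)"
      by (simp only: mult_ac)
    also have "\<dots> = (\<integral>\<eta>. cnj (G \<eta>) * synth G \<eta> \<partial>lborel)"
      unfolding synth_def by simp
    finally show ?thesis .
  qed
  have II: "integrable lborel (\<lambda>x. ((cmod (G x))\<^sup>2 + (cmod (synth G x))\<^sup>2) / 2)"
    using I(1) J(2) by simp
  have "?s \<le> cmod (complex_of_real ?s)" by simp
  also have "\<dots> \<le> (\<integral>x. ((cmod (G x))\<^sup>2 + (cmod (synth G x))\<^sup>2) / 2 \<partial>lborel)"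
    unfolding eq
  proof (rule Bochner_Integration.integral_norm_bound_integral)
    have *: "cmod (cnj (G x) * synth G x) \<le> ((cmod (G x))\<^sup>2 + (cmod (synth G x))\<^sup>2) / 2" for x
      using sum_squares_bound[of "cmod (G x)" "cmod (synth G x)"] by (simp add: norm_mult)
    then show "cmod (cnj (G x) * synth G x) \<le> ((cmod (G x))\<^sup>2 + (cmod (synth G x))\<^sup>2) / 2" for x .
    show "integrable lborel (\<lambda>x. cnj (G x) * synth G x)"
      by (rule Bochner_Integration.integrable_bound[OF II]) (use * in auto)
  qed (rule II)
  also have "\<dots> = (?g + ?s) / 2"
    using I(1) J(2) by simp
  finally have "?s \<le> ?g" by simp
  then show ?thesis
    using nn_integral_eq_integral[OF I(1)] nn_integral_eq_integral[OF J(2)] by (simp add: ennreal_leI)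
qed

end

subsection \<open>Averaging over all squares\<close>

text \<open>A point s lies in the segment starting at a exactly when a lies in [s - 1, s], an
  interval of length 1.\<close>

lemma nn_integral_sliding_segment:
  assumes [measurable]: "u \<in> borel_measurable (borel :: real measure)"
  shows "(\<integral>\<^sup>+ a. (\<integral>\<^sup>+ s. u s * indicator {a..a + 1} s \<partial>lborel) \<partial>lborel) = (\<integral>\<^sup>+ s. u s \<partial>lborel)"
proof -
  have [measurable]: "(\<lambda>p. indicator {fst p..fst p + 1} (snd p) :: ennreal)
      \<in> borel_measurable (lborel \<Otimes>\<^sub>M (lborel :: real measure))"
    by (simp add: indicator_def) measurable
  have "(\<integral>\<^sup>+ a. (\<integral>\<^sup>+ s. u s * indicator {a..a + 1} s \<partial>lborel) \<partial>lborel)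
     = (\<integral>\<^sup>+ s. (\<integral>\<^sup>+ a. u s * indicator {a..a + 1} s \<partial>lborel) \<partial>lborel)"
    by (rule lborel_pair.Fubini'[symmetric]) (simp add: split_beta)
  also have "\<dots> = (\<integral>\<^sup>+ s. (\<integral>\<^sup>+ a. u s * indicator {s - 1..s} a \<partial>lborel) \<partial>lborel)"
    by (intro nn_integral_cong) (auto split: split_indicator)
  also have "\<dots> = (\<integral>\<^sup>+ s. u s \<partial>lborel)"
    by (simp add: nn_integral_cmult_indicator)
  finally show ?thesis .
qed

lemma emeasure_unit_cbox: "emeasure lborel (cbox (x - (1, 1)) (x :: real \<times> real)) = 1"
proof (cases x)
  case (Pair a b)
  then have "cbox (x - (1, 1)) x = {a - 1..a} \<times> {b - 1..b}"
    by (simp add: cbox_Pair_eq)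
  then show ?thesis
    by (simp add: lborel_prod[symmetric] lborel.emeasure_pair_measure_Times)
qed

lemma nn_integral_shift:
  fixes c :: real
  assumes "u \<in> borel_measurable borel"
  shows "(\<integral>\<^sup>+ s. u (s + c) \<partial>lborel) = (\<integral>\<^sup>+ s. u s \<partial>lborel)"
  using nn_integral_real_affine[OF assms, of 1 c] by (simp add: add.commute)

lemma measurable_indicator_unit_square [measurable]:
  "(\<lambda>z. indicator ((\<lambda>x. fst z + x) ` unit_square) (snd z) :: ennreal) \<in> borel_measurable (borel \<Otimes>\<^sub>M borel)"
  unfolding indicator_def mem_translated_unit_square by measurable

text \<open>For an edge integral, one coordinate of the corner slides a segment along the edge while
  the other moves the edge across the plane; the offset 1 of an upper edge vanishes by translation
  invariance. Thus edges contribute full integrals just as the area does.\<close>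

lemma nn_integral_sliding_square:
  assumes [measurable]: "u \<in> borel_measurable (borel :: (real \<times> real) measure)"
  shows "(\<integral>\<^sup>+ \<rho>. (\<integral>\<^sup>+ s. u (s, snd \<rho> + 1) * indicator {fst \<rho>..fst \<rho> + 1} s \<partial>lborel) \<partial>lborel) = (\<integral>\<^sup>+ x. u x \<partial>lborel)"
    and "(\<integral>\<^sup>+ \<rho>. (\<integral>\<^sup>+ t. u (fst \<rho> + 1, t) * indicator {snd \<rho>..snd \<rho> + 1} t \<partial>lborel) \<partial>lborel) = (\<integral>\<^sup>+ x. u x \<partial>lborel)"
    and "(\<integral>\<^sup>+ \<rho>. (\<integral>\<^sup>+ x. u x * indicator ((\<lambda>x. \<rho> + x) ` unit_square) x \<partial>lborel) \<partial>lborel) = (\<integral>\<^sup>+ x. u x \<partial>lborel)"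
proof -
  have i1: "(\<lambda>\<rho> :: real \<times> real. \<integral>\<^sup>+ s. u (s, snd \<rho> + 1) * indicator {fst \<rho>..fst \<rho> + 1} s \<partial>lborel) \<in> borel_measurable borel"
    "(\<lambda>\<rho> :: real \<times> real. \<integral>\<^sup>+ t. u (fst \<rho> + 1, t) * indicator {snd \<rho>..snd \<rho> + 1} t \<partial>lborel) \<in> borel_measurable borel"
    by (simp_all add: indicator_def) measurable
  have "(\<integral>\<^sup>+ \<rho>. (\<integral>\<^sup>+ s. u (s, snd \<rho> + 1) * indicator {fst \<rho>..fst \<rho> + 1} s \<partial>lborel) \<partial>lborel)
     = (\<integral>\<^sup>+ b. (\<integral>\<^sup>+ a. (\<integral>\<^sup>+ s. u (s, b + 1) * indicator {a..a + 1} s \<partial>lborel) \<partial>lborel) \<partial>lborel)"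
    by (subst nn_integral_lborel_Times(2)[OF i1(1)]) simp
  also have "\<dots> = (\<integral>\<^sup>+ b. (\<integral>\<^sup>+ s. u (s, b + 1) \<partial>lborel) \<partial>lborel)"
    by (intro nn_integral_cong nn_integral_sliding_segment) measurable
  also have "\<dots> = (\<integral>\<^sup>+ b. (\<integral>\<^sup>+ s. u (s, b) \<partial>lborel) \<partial>lborel)"
    by (rule nn_integral_shift[of "\<lambda>b. \<integral>\<^sup>+ s. u (s, b) \<partial>lborel"]) measurable
  also have "\<dots> = (\<integral>\<^sup>+ x. u x \<partial>lborel)"
    by (rule nn_integral_lborel_Times(2)[symmetric]) measurable
  finally show "(\<integral>\<^sup>+ \<rho>. (\<integral>\<^sup>+ s. u (s, snd \<rho> + 1) * indicator {fst \<rho>..fst \<rho> + 1} s \<partial>lborel) \<partial>lborel) = (\<integral>\<^sup>+ x. u x \<partial>lborel)" .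
  have "(\<integral>\<^sup>+ \<rho>. (\<integral>\<^sup>+ t. u (fst \<rho> + 1, t) * indicator {snd \<rho>..snd \<rho> + 1} t \<partial>lborel) \<partial>lborel)
     = (\<integral>\<^sup>+ a. (\<integral>\<^sup>+ b. (\<integral>\<^sup>+ t. u (a + 1, t) * indicator {b..b + 1} t \<partial>lborel) \<partial>lborel) \<partial>lborel)"
    by (subst nn_integral_lborel_Times(1)[OF i1(2)]) simp
  also have "\<dots> = (\<integral>\<^sup>+ a. (\<integral>\<^sup>+ t. u (a + 1, t) \<partial>lborel) \<partial>lborel)"
    by (intro nn_integral_cong nn_integral_sliding_segment) measurable
  also have "\<dots> = (\<integral>\<^sup>+ a. (\<integral>\<^sup>+ t. u (a, t) \<partial>lborel) \<partial>lborel)"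
    by (rule nn_integral_shift[of "\<lambda>a. \<integral>\<^sup>+ t. u (a, t) \<partial>lborel"]) measurable
  also have "\<dots> = (\<integral>\<^sup>+ x. u x \<partial>lborel)"
    by (rule nn_integral_lborel_Times(1)[symmetric]) measurable
  finally show "(\<integral>\<^sup>+ \<rho>. (\<integral>\<^sup>+ t. u (fst \<rho> + 1, t) * indicator {snd \<rho>..snd \<rho> + 1} t \<partial>lborel) \<partial>lborel) = (\<integral>\<^sup>+ x. u x \<partial>lborel)" .
  have "(\<integral>\<^sup>+ \<rho>. (\<integral>\<^sup>+ x. u x * indicator ((\<lambda>x. \<rho> + x) ` unit_square) x \<partial>lborel) \<partial>lborel)
     = (\<integral>\<^sup>+ x. (\<integral>\<^sup>+ \<rho>. u x * indicator ((\<lambda>x. \<rho> + x) ` unit_square) x \<partial>lborel) \<partial>lborel)"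
    by (rule lborel_pair.Fubini'[symmetric]) (simp add: split_beta)
  \<comment> \<open>The square with lower left corner \<open>\<rho>\<close> contains x exactly when
    \<open>\<rho>\<close> lies in the unit square with upper right corner x.\<close>
  also have "\<dots> = (\<integral>\<^sup>+ x. (\<integral>\<^sup>+ \<rho>. u x * indicator (cbox (x - (1, 1)) x) \<rho> \<partial>lborel) \<partial>lborel)"
    by (intro nn_integral_cong arg_cong2[of _ _ _ _ "(*)"] refl)
      (auto simp: indicator_def mem_translated_unit_square cbox_Pair_iff)
  also have "\<dots> = (\<integral>\<^sup>+ x. u x \<partial>lborel)"
    by (simp add: nn_integral_cmult_indicator emeasure_unit_cbox)
  finally show "(\<integral>\<^sup>+ \<rho>. (\<integral>\<^sup>+ x. u x * indicator ((\<lambda>x. \<rho> + x) ` unit_square) x \<partial>lborel) \<partial>lborel) = (\<integral>\<^sup>+ x. u x \<partial>lborel)" .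
qed

section \<open>Variation of the kernel on a moving square\<close>

context parseval_frame
begin

text \<open>The factor of D in the Koksma-Hlawka bound on the square at \<open>\<rho>\<close>: the
  Hardy-Krause variation of a smooth kernel anchored at the upper corner.\<close>

definition variation :: "real \<times> real \<Rightarrow> (real \<times> real) \<times> (real \<times> real) \<Rightarrow> ennreal" where
  "variation \<rho> p =
     (\<integral>\<^sup>+ s. upper1 (frame_K \<psi> (fst p) (snd p)) (s, snd \<rho> + 1) * indicator {fst \<rho>..fst \<rho> + 1} s \<partial>lborel)
    + (\<integral>\<^sup>+ t. upper2 (frame_K \<psi> (fst p) (snd p)) (fst \<rho> + 1, t) * indicator {snd \<rho>..snd \<rho> + 1} t \<partial>lborel)
    + (\<integral>\<^sup>+ x. upper12 (frame_K \<psi> (fst p) (snd p)) x * indicator ((\<lambda>x. \<rho> + x) ` unit_square) x \<partial>lborel)"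

lemma measurable_local_variation:
  assumes [measurable]: "a \<in> borel_measurable M" "b \<in> borel_measurable M"
    "f \<in> measurable M borel" "g \<in> measurable M borel"
  shows "(\<lambda>\<omega>. \<integral>\<^sup>+ s. upper1 (frame_K \<psi> (f \<omega>) (g \<omega>)) (s, b \<omega> + 1) * indicator {a \<omega>..a \<omega> + 1} s \<partial>lborel)
      \<in> borel_measurable M"
    and "(\<lambda>\<omega>. \<integral>\<^sup>+ t. upper2 (frame_K \<psi> (f \<omega>) (g \<omega>)) (a \<omega> + 1, t) * indicator {b \<omega>..b \<omega> + 1} t \<partial>lborel)
      \<in> borel_measurable M"
    and "(\<lambda>\<omega>. \<integral>\<^sup>+ x. upper12 (frame_K \<psi> (f \<omega>) (g \<omega>)) x * indicator ((\<lambda>x. (a \<omega>, b \<omega>) + x) ` unit_square) x \<partial>lborel)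
      \<in> borel_measurable M"
  unfolding indicator_def mem_translated_unit_square atLeastAtMost_iff fst_conv snd_conv by measurable

lemma measurable_variation [measurable]:
  assumes r: "r \<in> measurable M borel" and q: "q \<in> measurable M borel"
  shows "(\<lambda>\<omega>. variation (r \<omega>) (q \<omega>)) \<in> borel_measurable M"
proof -
  note m = measurable_compose[OF r measurable_fst_snd_borel(1)] measurable_compose[OF r measurable_fst_snd_borel(2)]
    measurable_compose[OF q measurable_fst_snd_borel(3)] measurable_compose[OF q measurable_fst_snd_borel(4)]
  show ?thesis
    unfolding variation_def
    by (intro borel_measurable_add measurable_local_variation[OF m, unfolded prod.collapse])
qed

lemma nn_integral_variation: "(\<integral>\<^sup>+ \<rho>. variation \<rho> p \<partial>lborel) = weight (fst p) (snd p)"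
proof -
  have c: "(\<lambda>_ :: real \<times> real. fst p) \<in> measurable borel borel" "(\<lambda>_ :: real \<times> real. snd p) \<in> measurable borel borel"
    by (rule measurable_const; simp)+
  note m = measurable_upper[OF c, of "\<lambda>x. x", OF measurable_ident_sets[OF refl]]
  note v = measurable_local_variation[OF measurable_fst_snd_borel(1,2) c, unfolded prod.collapse]
  have add: "(\<integral>\<^sup>+ x. f x + g x + h x \<partial>lborel) = (\<integral>\<^sup>+ x. f x \<partial>lborel) + (\<integral>\<^sup>+ x. g x \<partial>lborel) + (\<integral>\<^sup>+ x. h x \<partial>lborel)"
    if "f \<in> borel_measurable borel" "g \<in> borel_measurable borel" "h \<in> borel_measurable borel"
    for f g h :: "real \<times> real \<Rightarrow> ennreal"
    using that by (simp add: nn_integral_add)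
  have "(\<integral>\<^sup>+ \<rho>. variation \<rho> p \<partial>lborel) = (\<integral>\<^sup>+ x. upper1 (frame_K \<psi> (fst p) (snd p)) x \<partial>lborel)
      + (\<integral>\<^sup>+ x. upper2 (frame_K \<psi> (fst p) (snd p)) x \<partial>lborel)
      + (\<integral>\<^sup>+ x. upper12 (frame_K \<psi> (fst p) (snd p)) x \<partial>lborel)"
    unfolding variation_def add[OF v]
    by (simp only: nn_integral_sliding_square(1)[OF m(1)] nn_integral_sliding_square(2)[OF m(2)]
        nn_integral_sliding_square(3)[OF m(3)])
  also have "\<dots> = weight (fst p) (snd p)"
    unfolding weight_def using add[OF m] by simp
  finally show ?thesis .
qed

end

section \<open>Sampled sums against averages over squares\<close>

locale sampled_frame = smooth_parseval_frame \<psi> + sampling_set \<Lambda>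
  for \<psi> :: "real \<times> real \<Rightarrow> 'a::complex_hilbert" and \<Lambda>
begin

abbreviation "square \<rho> \<equiv> (\<lambda>x. \<rho> + x) ` unit_square"

definition sampled :: "(real \<times> real \<Rightarrow> complex) \<Rightarrow> real \<times> real \<Rightarrow> real" where
  "sampled G \<rho> = (\<Sum>l\<in>\<Lambda> \<inter> square \<rho>. (cmod (synth G l))\<^sup>2) / real (count_N \<Lambda> \<rho>)"

definition averaged :: "(real \<times> real \<Rightarrow> complex) \<Rightarrow> real \<times> real \<Rightarrow> real" where
  "averaged G \<rho> = (\<integral>x. (cmod (synth G x))\<^sup>2 \<partial>restrict_space lborel (square \<rho>))"

lemma square_borel [measurable]: "square \<rho> \<in> sets borel"
  unfolding unit_square_def cbox_translation[symmetric] by simp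

text \<open>Both quantities are integrals over p of the same coefficients against a linear
  functional of the kernel, namely the mean over the sample points and the mean over the square.
  Koksma-Hlawka bounds the difference of the functionals for almost every p.\<close>

lemma local_error:
  assumes G: "nice G"
  shows "ennreal \<bar>sampled G \<rho> - averaged G \<rho>\<bar>
    \<le> (\<integral>\<^sup>+ p. ennreal (cmod (G (snd p)) * cmod (G (fst p))) * (ennreal D * variation \<rho> p) \<partial>lborel)"
proof -
  let ?M = "restrict_space lborel (square \<rho>)"
  let ?K = "\<lambda>p. frame_K \<psi> (fst p) (snd p)"
  let ?g = "\<lambda>p. G (snd p) * cnj (G (fst p))"
  let ?S = "\<lambda>p. (\<Sum>l\<in>\<Lambda> \<inter> square \<rho>. ?K p l) / real (count_N \<Lambda> \<rho>)"
  have sf: "sigma_finite_measure ?M"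
    by (rule sigma_finite_measure_restrict_space) (auto intro: lborel.sigma_finite_measure_axioms)
  have m: "(\<lambda>x. x) \<in> measurable ?M borel"
    by (intro measurable_restrict_space1) auto
  have "(\<integral>\<^sup>+ x. (\<integral>\<^sup>+ p. ennreal (cmod (kern G p x)) \<partial>lborel) \<partial>?M)
      \<le> (\<integral>\<^sup>+ x. (\<integral>\<^sup>+ p. ennreal (cmod (kern G p x)) \<partial>lborel) \<partial>lborel)"
    by (subst nn_integral_restrict_space) (auto intro!: nn_integral_mono split: split_indicator)
  also have "\<dots> < \<infinity>"
    by (rule kern_total_finite[OF G])
  finally have "(\<integral>\<^sup>+ x. (\<integral>\<^sup>+ p. ennreal (cmod (kern G p x)) \<partial>lborel) \<partial>?M) < \<infinity>" .
  note F = synth_Fubini[OF G sf m this]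
  have S: "complex_of_real (sampled G \<rho>) = (\<integral>p. ?g p * ?S p \<partial>lborel)" and iS: "integrable lborel (\<lambda>p. ?g p * ?S p)"
  proof -
    have eq: "?g p * ?S p = (\<Sum>l\<in>\<Lambda> \<inter> square \<rho>. kern G p l) / real (count_N \<Lambda> \<rho>)" for p
      by (simp add: kern_def sum_distrib_left)
    show "integrable lborel (\<lambda>p. ?g p * ?S p)"
      unfolding eq by (intro integrable_divide Bochner_Integration.integrable_sum integral_kern(1) G)
    have "complex_of_real (sampled G \<rho>)
        = (\<Sum>l\<in>\<Lambda> \<inter> square \<rho>. (\<integral>p. kern G p l \<partial>lborel)) / real (count_N \<Lambda> \<rho>)"
      by (simp add: integral_kern(2)[OF G] sampled_def)
    also have "\<dots> = (\<integral>p. ?g p * ?S p \<partial>lborel)"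
      unfolding eq by (simp add: Bochner_Integration.integral_sum integral_kern(1)[OF G])
    finally show "complex_of_real (sampled G \<rho>) = (\<integral>p. ?g p * ?S p \<partial>lborel)" .
  qed
  have diff: "complex_of_real (sampled G \<rho> - averaged G \<rho>) = (\<integral>p. ?g p * (?S p - (\<integral>x. ?K p x \<partial>?M)) \<partial>lborel)"
    unfolding of_real_diff S averaged_def F(3) using iS F(2) by (simp add: right_diff_distrib)
  have idiff: "integrable lborel (\<lambda>p. ?g p * (?S p - (\<integral>x. ?K p x \<partial>?M)))"
    using Bochner_Integration.integrable_diff[OF iS F(2)] by (simp add: right_diff_distrib)
  have "ennreal \<bar>sampled G \<rho> - averaged G \<rho>\<bar> = ennreal (cmod (complex_of_real (sampled G \<rho> - averaged G \<rho>)))"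
    unfolding norm_of_real by simp
  also have "\<dots> \<le> (\<integral>\<^sup>+ p. ennreal (cmod (?g p * (?S p - (\<integral>x. ?K p x \<partial>?M)))) \<partial>lborel)"
    unfolding diff by (rule integral_norm_bound_ennreal[OF idiff])
  also have "\<dots> \<le> (\<integral>\<^sup>+ p. ennreal (cmod (G (snd p)) * cmod (G (fst p))) * (ennreal D * variation \<rho> p) \<partial>lborel)"
  proof (rule nn_integral_mono_AE, use smooth in eventually_elim)
    fix p assume "has_cont_mixed_partials (?K p)"
    from Koksma_Hlawka[OF this, of \<rho>]
    have "ennreal (cmod (?S p - (\<integral>x. ?K p x \<partial>?M))) \<le> ennreal D * variation \<rho> p"
      unfolding variation_def .
    moreover have "ennreal (cmod (?g p * (?S p - (\<integral>x. ?K p x \<partial>?M))))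
       = ennreal (cmod (G (snd p)) * cmod (G (fst p))) * ennreal (cmod (?S p - (\<integral>x. ?K p x \<partial>?M)))"
      unfolding norm_mult complex_mod_cnj by (rule ennreal_mult) auto
    ultimately show "ennreal (cmod (?g p * (?S p - (\<integral>x. ?K p x \<partial>?M))))
       \<le> ennreal (cmod (G (snd p)) * cmod (G (fst p))) * (ennreal D * variation \<rho> p)"
      by (simp add: mult_left_mono)
  qed
  finally show ?thesis .
qed

lemma total_error:
  assumes G: "nice G"
  shows "(\<integral>\<^sup>+ \<rho>. (\<integral>\<^sup>+ p. ennreal (cmod (G (snd p)) * cmod (G (fst p))) * (ennreal D * variation \<rho> p) \<partial>lborel) \<partial>lborel)
     \<le> ennreal D * Omega \<psi> * (\<integral>\<^sup>+ x. ennreal ((cmod (G x))\<^sup>2) \<partial>lborel)"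
proof -
  have [measurable]: "G \<in> borel_measurable borel" using G by (simp add: nice_def)
  have "(\<integral>\<^sup>+ \<rho>. (\<integral>\<^sup>+ p. ennreal (cmod (G (snd p)) * cmod (G (fst p))) * (ennreal D * variation \<rho> p) \<partial>lborel) \<partial>lborel)
    = (\<integral>\<^sup>+ p. (\<integral>\<^sup>+ \<rho>. ennreal (cmod (G (snd p)) * cmod (G (fst p))) * (ennreal D * variation \<rho> p) \<partial>lborel) \<partial>lborel)"
    by (rule lborel_pair.Fubini'[symmetric]) (simp add: split_beta)
  also have "\<dots> = (\<integral>\<^sup>+ p. ennreal D * (ennreal (cmod (G (snd p)) * cmod (G (fst p))) * weight (fst p) (snd p)) \<partial>lborel)"
    by (intro nn_integral_cong) (simp add: nn_integral_cmult nn_integral_variation mult.left_commute)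
  also have "\<dots> = ennreal D * (\<integral>\<^sup>+ p. ennreal (cmod (G (snd p)) * cmod (G (fst p))) * weight (fst p) (snd p) \<partial>lborel)"
    by (rule nn_integral_cmult) measurable
  also have "\<dots> \<le> ennreal D * (Omega \<psi> * (\<integral>\<^sup>+ x. ennreal ((cmod (G x))\<^sup>2) \<partial>lborel))"
    by (intro mult_left_mono Schur_test) auto
  finally show ?thesis by (simp add: mult.assoc)
qed

lemma averaged_nonneg: "0 \<le> averaged G \<rho>"
  unfolding averaged_def by simp

lemma sampled_nonneg: "0 \<le> sampled G \<rho>"
  unfolding sampled_def by (simp add: sum_nonneg)

lemma ennreal_averaged:
  assumes "nice G"
  shows "ennreal (averaged G \<rho>) = (\<integral>\<^sup>+ x. ennreal ((cmod (synth G x))\<^sup>2) * indicator (square \<rho>) x \<partial>lborel)"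
proof -
  have "integrable (restrict_space lborel (square \<rho>)) (\<lambda>x. (cmod (synth G x))\<^sup>2)"
    using integrable_mult_indicator[OF _ synth_Fubini_lborel(1)[OF assms], of "square \<rho>"]
    by (simp add: integrable_restrict_space)
  from nn_integral_eq_integral[OF this] show ?thesis
    unfolding averaged_def by (subst nn_integral_restrict_space[symmetric]) auto
qed

lemma ennreal_sampled:
  "ennreal (sampled G \<rho>)
    = (\<integral>\<^sup>+ l. ennreal (indicator (square \<rho>) l / real (count_N \<Lambda> \<rho>) * (cmod (synth G l))\<^sup>2) \<partial>count_space \<Lambda>)"
proof -
  have fin: "finite (\<Lambda> \<inter> square \<rho>)"
    by (rule discrete) (auto simp: unit_square_def cbox_translation[symmetric])
  have "ennreal (sampled G \<rho>) = (\<Sum>l\<in>\<Lambda> \<inter> square \<rho>. ennreal (indicator (square \<rho>) l / real (count_N \<Lambda> \<rho>) * (cmod (synth G l))\<^sup>2))"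
    unfolding sampled_def sum_divide_distrib by (subst sum_ennreal) (auto intro!: arg_cong[of _ _ ennreal] sum.cong)
  then show ?thesis
    by (subst nn_integral_count_space'[OF fin]) auto
qed

lemma weight_a_nonneg: "0 \<le> weight_a \<Lambda> l"
  unfolding weight_a_def by (intro Bochner_Integration.integral_nonneg) simp

lemma measurable_indicator_square [measurable]: "(\<lambda>\<rho>. indicator (square \<rho>) l :: real) \<in> borel_measurable borel"
  unfolding indicator_def mem_translated_unit_square by measurable

text \<open>The Bochner integral defining the weights is 0 by convention for a non-integrable
  function, so integrability must be shown: each count is at least 1 and the integrand is supported
  on a unit square.\<close>

lemma ennreal_weight_a:
  "ennreal (weight_a \<Lambda> l) = (\<integral>\<^sup>+ \<rho>. ennreal (indicator (square \<rho>) l / real (count_N \<Lambda> \<rho>)) \<partial>lborel)"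
proof -
  have "integrable lborel (\<lambda>\<rho>. indicator (square \<rho>) l / real (count_N \<Lambda> \<rho>) :: real)"
  proof (rule Bochner_Integration.integrable_bound)
    show "integrable lborel (indicat_real (cbox (l - (1, 1)) l))"
      by (intro integrable_real_indicator) (auto simp: emeasure_unit_cbox)
    have "norm (indicator (square \<rho>) l / real (count_N \<Lambda> \<rho>) :: real) \<le> norm (indicat_real (cbox (l - (1, 1)) l) \<rho>)" for \<rho>
      using count_pos[of \<rho>] by (cases l; cases \<rho>) (auto simp: indicator_def mem_translated_unit_square cbox_Pair_iff divide_le_eq)
    then show "AE \<rho> in lborel. norm (indicator (square \<rho>) l / real (count_N \<Lambda> \<rho>) :: real) \<le> norm (indicat_real (cbox (l - (1, 1)) l) \<rho>)"
      by simp
  qed measurable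
  from nn_integral_eq_integral[OF this] show ?thesis
    unfolding weight_a_def by simp
qed

lemma nn_integral_sampled:
  "(\<integral>\<^sup>+ \<rho>. ennreal (sampled G \<rho>) \<partial>lborel) = (\<integral>\<^sup>+ l. ennreal (weight_a \<Lambda> l * (cmod (synth G l))\<^sup>2) \<partial>count_space \<Lambda>)"
proof -
  have "(\<integral>\<^sup>+ \<rho>. ennreal (sampled G \<rho>) \<partial>lborel) = (\<integral>\<^sup>+ l. (\<integral>\<^sup>+ \<rho>.
      ennreal (indicator (square \<rho>) l / real (count_N \<Lambda> \<rho>) * (cmod (synth G l))\<^sup>2) \<partial>lborel) \<partial>count_space \<Lambda>)"
    unfolding ennreal_sampled by (rule nn_integral_count_space_nn_integral[OF countable_points]) measurable
  also have "\<dots> = (\<integral>\<^sup>+ l. ennreal (weight_a \<Lambda> l * (cmod (synth G l))\<^sup>2) \<partial>count_space \<Lambda>)"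
    by (intro nn_integral_cong)
      (simp add: ennreal_mult' ennreal_mult'' weight_a_nonneg nn_integral_multc ennreal_weight_a del: times_divide_eq_left)
  finally show ?thesis .
qed

text \<open>The finite index set moves with the square. Rewriting the sum as an integral over all of
  \<open>\<Lambda>\<close> with an indicator fixes the index set, and countability makes that
  integral measurable in the parameter.\<close>

lemma measurable_sampled [measurable]: "(\<lambda>\<rho>. ennreal (sampled G \<rho>)) \<in> borel_measurable borel"
proof -
  interpret C: sigma_finite_measure "count_space \<Lambda>"
    by (rule sigma_finite_measure_count_space_countable[OF countable_points])
  have "(\<lambda>z. ennreal (indicator (square (snd z)) (fst z) / real (count_N \<Lambda> (snd z)) * (cmod (synth G (fst z)))\<^sup>2))
      \<in> borel_measurable (count_space \<Lambda> \<Otimes>\<^sub>M borel)"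
    by (rule measurable_pair_measure_countable1[OF countable_points]) simp
  from measurable_compose[OF measurable_pair_swap' this]
  have "(\<lambda>z. ennreal (indicator (square (fst z)) (snd z) / real (count_N \<Lambda> (fst z)) * (cmod (synth G (snd z)))\<^sup>2))
      \<in> borel_measurable (borel \<Otimes>\<^sub>M count_space \<Lambda>)"
    by (simp add: split_beta)
  from C.borel_measurable_nn_integral_fst[OF this] show ?thesis
    unfolding ennreal_sampled by simp
qed

lemma nn_integral_averaged:
  assumes "nice G"
  shows "(\<integral>\<^sup>+ \<rho>. ennreal (averaged G \<rho>) \<partial>lborel) = (\<integral>\<^sup>+ x. ennreal ((cmod (synth G x))\<^sup>2) \<partial>lborel)"
proof -
  have [measurable]: "G \<in> borel_measurable borel" using assms by (simp add: nice_def)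
  show ?thesis
    unfolding ennreal_averaged[OF assms] by (intro nn_integral_sliding_square(3)) measurable
qed

text \<open>The local error is integrated over all positions in both directions; the additive form
  avoids subtraction in \<open>ennreal\<close>. Note that E contains G and not
  \<open>synth G\<close>, since G is what multiplies the kernel.\<close>

lemma sampling_inequalities:
  assumes G: "nice G"
  defines "S \<equiv> (\<integral>\<^sup>+ l. ennreal (weight_a \<Lambda> l * (cmod (synth G l))\<^sup>2) \<partial>count_space \<Lambda>)"
    and "I \<equiv> (\<integral>\<^sup>+ x. ennreal ((cmod (synth G x))\<^sup>2) \<partial>lborel)"
    and "E \<equiv> ennreal D * Omega \<psi> * (\<integral>\<^sup>+ x. ennreal ((cmod (G x))\<^sup>2) \<partial>lborel)"
  shows "S \<le> I + E" "I \<le> S + E"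
proof -
  have [measurable]: "G \<in> borel_measurable borel" using G by (simp add: nice_def)
  define C where "C \<rho> = (\<integral>\<^sup>+ p. ennreal (cmod (G (snd p)) * cmod (G (fst p))) * (ennreal D * variation \<rho> p) \<partial>lborel)" for \<rho>
  have [measurable]: "C \<in> borel_measurable borel"
    unfolding C_def[abs_def] by (rule lborel.borel_measurable_nn_integral) (simp add: split_beta)
  have [measurable]: "(\<lambda>\<rho>. ennreal (averaged G \<rho>)) \<in> borel_measurable borel"
    unfolding ennreal_averaged[OF G] indicator_def mem_translated_unit_square by measurable
  have C: "(\<integral>\<^sup>+ \<rho>. C \<rho> \<partial>lborel) \<le> E"
    unfolding C_def E_def by (rule total_error[OF G])
  have le: "ennreal (sampled G \<rho>) \<le> ennreal (averaged G \<rho>) + C \<rho>"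
    "ennreal (averaged G \<rho>) \<le> ennreal (sampled G \<rho>) + C \<rho>" for \<rho>
  proof -
    have "ennreal (sampled G \<rho>) \<le> ennreal (averaged G \<rho> + \<bar>sampled G \<rho> - averaged G \<rho>\<bar>)"
      "ennreal (averaged G \<rho>) \<le> ennreal (sampled G \<rho> + \<bar>sampled G \<rho> - averaged G \<rho>\<bar>)"
      by (auto intro!: ennreal_leI)
    then show "ennreal (sampled G \<rho>) \<le> ennreal (averaged G \<rho>) + C \<rho>"
      "ennreal (averaged G \<rho>) \<le> ennreal (sampled G \<rho>) + C \<rho>"
      using local_error[OF G, of \<rho>] unfolding C_def
      by (auto simp: averaged_nonneg sampled_nonneg elim!: order_trans intro!: add_left_mono)
  qed
  have "S \<le> (\<integral>\<^sup>+ \<rho>. ennreal (averaged G \<rho>) + C \<rho> \<partial>lborel)"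
    unfolding S_def nn_integral_sampled[symmetric] by (intro nn_integral_mono le)
  also have "\<dots> = I + (\<integral>\<^sup>+ \<rho>. C \<rho> \<partial>lborel)"
    by (simp add: nn_integral_add I_def nn_integral_averaged[OF G])
  also have "\<dots> \<le> I + E" by (rule add_left_mono[OF C])
  finally show "S \<le> I + E" .
  have "I \<le> (\<integral>\<^sup>+ \<rho>. ennreal (sampled G \<rho>) + C \<rho> \<partial>lborel)"
    unfolding I_def nn_integral_averaged[OF G, symmetric] by (intro nn_integral_mono le)
  also have "\<dots> = S + (\<integral>\<^sup>+ \<rho>. C \<rho> \<partial>lborel)"
    by (simp add: nn_integral_add S_def nn_integral_sampled)
  also have "\<dots> \<le> S + E" by (rule add_left_mono[OF C])
  finally show "I \<le> S + E" .
qed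

end

subsection \<open>Removing the cut-off\<close>

lemma nn_integral_count_space_infsum:
  fixes g :: "'a \<Rightarrow> real"
  assumes nonneg: "\<And>x. 0 \<le> g x" and fin: "(\<integral>\<^sup>+ x. ennreal (g x) \<partial>count_space A) < \<infinity>"
  shows "g summable_on A" and "ennreal (infsum g A) = (\<integral>\<^sup>+ x. ennreal (g x) \<partial>count_space A)"
proof -
  have "integrable (count_space A) g"
    using fin nonneg by (intro integrableI_nonneg) auto
  then have *: "Infinite_Set_Sum.abs_summable_on g A"
    by (simp add: Infinite_Set_Sum.abs_summable_on_def)
  then have "(\<lambda>x. norm (g x)) summable_on A"
    by (rule abs_summable_equivalent[THEN iffD2])
  then show "g summable_on A" using nonneg by simp
  show "ennreal (infsum g A) = (\<integral>\<^sup>+ x. ennreal (g x) \<partial>count_space A)"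
    using nn_integral_conv_infsetsum[OF *] nonneg infsetsum_infsum[OF *] by simp
qed

section \<open>Coefficient functions restricted to a set\<close>

context parseval_frame
begin

definition core :: "nat \<Rightarrow> (real \<times> real) set" where
  "core n = {\<nu>. norm \<nu> \<le> real n \<and> norm (\<psi> \<nu>) \<le> real n}"

definition restr :: "'a \<Rightarrow> (real \<times> real) set \<Rightarrow> real \<times> real \<Rightarrow> complex" where
  "restr f S \<nu> = indicator S \<nu> *\<^sub>R hinner f (\<psi> \<nu>)"

lemma core_borel [measurable]: "core n \<in> sets borel"
proof -
  have "{\<nu> \<in> space borel. norm \<nu> \<le> real n \<and> norm (\<psi> \<nu>) \<le> real n} \<in> sets borel"
    by measurable
  then show ?thesis by (simp add: core_def)
qed

lemma eventually_core: "\<forall>\<^sub>F n in sequentially. \<nu> \<in> core n"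
proof -
  obtain k :: nat where k: "max (norm \<nu>) (norm (\<psi> \<nu>)) \<le> real k"
    using real_arch_simple by blast
  have "\<nu> \<in> core n" if "n \<ge> k" for n
    using k that of_nat_mono[OF that, where 'a = real] unfolding core_def by auto
  then show ?thesis by (auto simp: eventually_sequentially)
qed

lemma measurable_restr [measurable]:
  assumes [measurable]: "S \<in> sets borel"
  shows "restr f S \<in> borel_measurable borel"
  unfolding restr_def[abs_def] by measurable

lemma norm_restr_le: "cmod (restr f S \<nu>) \<le> cmod (hinner f (\<psi> \<nu>))"
  unfolding restr_def by (auto split: split_indicator)

lemma nice_restr:
  assumes "S \<in> sets borel"
  shows "nice (restr f (S \<inter> core n))"
proof -
  obtain k :: nat where k: "max (real n) (norm f * real n) \<le> real k"
    using real_arch_simple by blast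
  have "norm \<nu> \<le> k \<and> norm (\<psi> \<nu>) \<le> k \<and> cmod (restr f (S \<inter> core n) \<nu>) \<le> k" if "restr f (S \<inter> core n) \<nu> \<noteq> 0" for \<nu>
  proof -
    have \<nu>: "norm \<nu> \<le> n" "norm (\<psi> \<nu>) \<le> n"
      using that by (auto simp: restr_def core_def split: split_indicator_asm)
    have "cmod (restr f (S \<inter> core n) \<nu>) \<le> norm f * norm (\<psi> \<nu>)"
      using norm_restr_le[of f "S \<inter> core n" \<nu>] hinner_Cauchy_Schwarz[of f "\<psi> \<nu>"] by linarith
    also have "\<dots> \<le> norm f * n"
      using \<nu> by (intro mult_left_mono) auto
    finally show ?thesis using \<nu> k by auto
  qed
  then show ?thesis
    unfolding nice_def using assms by (auto intro!: exI[of _ k])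
qed

lemma integrable_restr:
  assumes "S \<in> sets borel"
  shows "integrable lborel (\<lambda>\<nu>. restr f S \<nu> * hinner (\<psi> \<nu>) (\<psi> x))"
  by (rule Bochner_Integration.integrable_bound[OF integrable_frame_product[of f "\<psi> x"]])
    (use assms in \<open>auto simp: norm_mult intro!: mult_right_mono norm_restr_le\<close>)

lemma synth_restr_UNIV: "synth (restr f UNIV) x = hinner f (\<psi> x)"
  unfolding synth_def restr_def by (simp add: reproducing)

lemma synth_restr_tendsto:
  assumes [measurable]: "S \<in> sets borel"
  shows "(\<lambda>n. synth (restr f (S \<inter> core n)) x) \<longlonglongrightarrow> synth (restr f S) x"
  unfolding synth_def
proof (rule integral_dominated_convergence)
  show "integrable lborel (\<lambda>\<nu>. cmod (hinner f (\<psi> \<nu>) * hinner (\<psi> \<nu>) (\<psi> x)))"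
    by (intro integrable_norm integrable_frame_product)
  show "AE \<nu> in lborel. (\<lambda>n. restr f (S \<inter> core n) \<nu> * hinner (\<psi> \<nu>) (\<psi> x)) \<longlonglongrightarrow> restr f S \<nu> * hinner (\<psi> \<nu>) (\<psi> x)"
  proof (rule AE_I2, rule tendsto_eventually)
    fix \<nu>
    show "\<forall>\<^sub>F n in sequentially. restr f (S \<inter> core n) \<nu> * hinner (\<psi> \<nu>) (\<psi> x) = restr f S \<nu> * hinner (\<psi> \<nu>) (\<psi> x)"
      using eventually_core[of \<nu>] by eventually_elim (simp add: restr_def indicator_def)
  qed
  show "AE \<nu> in lborel. cmod (restr f (S \<inter> core n) \<nu> * hinner (\<psi> \<nu>) (\<psi> x))
      \<le> cmod (hinner f (\<psi> \<nu>) * hinner (\<psi> \<nu>) (\<psi> x))" for n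
    by (auto simp: norm_mult intro!: mult_right_mono norm_restr_le)
qed measurable

text \<open>Reproduction on the whole plane and linearity. The tail function need not be
  \<open>nice\<close>, so estimates for it pass through a further truncation.\<close>

lemma synth_restr_core: "synth (restr f (core n)) x = hinner f (\<psi> x) - synth (restr f (- core n)) x"
proof -
  have "synth (restr f (core n)) x + synth (restr f (- core n)) x
      = (\<integral>\<nu>. restr f (core n) \<nu> * hinner (\<psi> \<nu>) (\<psi> x) + restr f (- core n) \<nu> * hinner (\<psi> \<nu>) (\<psi> x) \<partial>lborel)"
    unfolding synth_def by (intro Bochner_Integration.integral_add[symmetric] integrable_restr) auto
  also have "\<dots> = synth (restr f UNIV) x"
    unfolding synth_def
    by (intro Bochner_Integration.integral_cong) (auto simp: restr_def split: split_indicator)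
  finally show ?thesis by (simp add: synth_restr_UNIV algebra_simps)
qed

definition energy :: "'a \<Rightarrow> (real \<times> real) set \<Rightarrow> ennreal" where
  "energy f S = (\<integral>\<^sup>+ x. ennreal ((cmod (restr f S x))\<^sup>2) \<partial>lborel)"

lemma energy_UNIV: "energy f UNIV = ennreal ((norm f)\<^sup>2)"
  unfolding energy_def restr_def by (simp add: parseval_nn)

lemma energy_mono: "S \<subseteq> T \<Longrightarrow> energy f S \<le> energy f T"
  unfolding energy_def restr_def
  by (intro nn_integral_mono ennreal_leI power_mono) (auto split: split_indicator)

lemma energy_tail_tendsto: "(\<lambda>n. energy f (- core n)) \<longlonglongrightarrow> 0"
proof -
  have "(\<lambda>n. energy f (- core n)) \<longlonglongrightarrow> (\<integral>\<^sup>+ x. 0 \<partial>(lborel :: (real \<times> real) measure))"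
    unfolding energy_def
  proof (rule nn_integral_dominated_convergence)
    show "(\<integral>\<^sup>+ x. ennreal ((cmod (hinner f (\<psi> x)))\<^sup>2) \<partial>lborel) < \<infinity>"
      by (simp add: parseval_nn)
    show "AE x in lborel. ennreal ((cmod (restr f (- core n) x))\<^sup>2) \<le> ennreal ((cmod (hinner f (\<psi> x)))\<^sup>2)" for n
      by (intro AE_I2 ennreal_leI power_mono norm_restr_le) auto
    show "AE x in lborel. (\<lambda>n. ennreal ((cmod (restr f (- core n) x))\<^sup>2)) \<longlonglongrightarrow> 0"
    proof (rule AE_I2, rule tendsto_eventually)
      fix x
      show "\<forall>\<^sub>F n in sequentially. ennreal ((cmod (restr f (- core n) x))\<^sup>2) = 0"
        using eventually_core[of x] by eventually_elim (simp add: restr_def)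
    qed
  qed measurable
  then show ?thesis by simp
qed

end

section \<open>Upper and lower frame bounds\<close>

context sampled_frame
begin

definition sampled_energy :: "(real \<times> real \<Rightarrow> complex) \<Rightarrow> ennreal" where
  "sampled_energy G = (\<integral>\<^sup>+ l. ennreal (weight_a \<Lambda> l * (cmod (synth G l))\<^sup>2) \<partial>count_space \<Lambda>)"

text \<open>The sets \<open>core n\<close> exhaust the plane, so Fatou over the sample points
  reduces the claim to truncations, where the sampling inequality and contractivity of
  \<open>synth\<close> apply. S = \<open>UNIV\<close> gives the upper frame bound; the complement of
  a core gives the tail estimate for the lower one.\<close>

lemma sampled_energy_restr_le:
  assumes S [measurable]: "S \<in> sets borel"
  shows "sampled_energy (restr f S) \<le> (1 + ennreal D * Omega \<psi>) * energy f S"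
proof -
  have lim: "liminf (\<lambda>n. ennreal (weight_a \<Lambda> l * (cmod (synth (restr f (S \<inter> core n)) l))\<^sup>2))
      = ennreal (weight_a \<Lambda> l * (cmod (synth (restr f S) l))\<^sup>2)" for l
    by (intro lim_imp_Liminf tendsto_ennrealI tendsto_mult tendsto_const tendsto_power tendsto_norm
        synth_restr_tendsto S) simp
  have "sampled_energy (restr f S)
      = (\<integral>\<^sup>+ l. liminf (\<lambda>n. ennreal (weight_a \<Lambda> l * (cmod (synth (restr f (S \<inter> core n)) l))\<^sup>2)) \<partial>count_space \<Lambda>)"
    unfolding sampled_energy_def lim ..
  also have "\<dots> \<le> liminf (\<lambda>n. sampled_energy (restr f (S \<inter> core n)))"
    unfolding sampled_energy_def by (rule nn_integral_liminf) simp
  also have "\<dots> \<le> (1 + ennreal D * Omega \<psi>) * energy f S"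
  proof (rule Liminf_le, simp, rule always_eventually, rule allI)
    fix n
    have N: "nice (restr f (S \<inter> core n))" by (rule nice_restr[OF S])
    have "sampled_energy (restr f (S \<inter> core n))
      \<le> (\<integral>\<^sup>+ x. ennreal ((cmod (synth (restr f (S \<inter> core n)) x))\<^sup>2) \<partial>lborel)
        + ennreal D * Omega \<psi> * energy f (S \<inter> core n)"
      unfolding sampled_energy_def energy_def by (rule sampling_inequalities(1)[OF N])
    also have "\<dots> \<le> energy f (S \<inter> core n) + ennreal D * Omega \<psi> * energy f (S \<inter> core n)"
      unfolding energy_def by (intro add_right_mono synth_contraction N)
    also have "\<dots> \<le> energy f S + ennreal D * Omega \<psi> * energy f S"
      by (intro add_mono mult_left_mono energy_mono) auto
    finally show "sampled_energy (restr f (S \<inter> core n)) \<le> (1 + ennreal D * Omega \<psi>) * energy f S"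
      by (simp add: distrib_right)
  qed
  finally show ?thesis .
qed

text \<open>Young's inequality puts a factor close to 1 on the main part and the large factor 1 +
  1/\<epsilon> on the tail, which vanishes as n grows for fixed \<epsilon>.\<close>

lemma sampled_energy_triangle:
  assumes "\<epsilon> > 0"
  shows "sampled_energy (restr f (core n)) \<le> ennreal (1 + \<epsilon>) * sampled_energy (restr f UNIV)
     + ennreal (1 + 1 / \<epsilon>) * sampled_energy (restr f (- core n))"
proof -
  have young: "(cmod (u - v))\<^sup>2 \<le> (1 + \<epsilon>) * (cmod u)\<^sup>2 + (1 + 1 / \<epsilon>) * (cmod v)\<^sup>2" for u v
  proof -
    have "0 \<le> (\<epsilon> * cmod u - cmod v)\<^sup>2 / \<epsilon>" using assms by simp
    also have "(\<epsilon> * cmod u - cmod v)\<^sup>2 / \<epsilon> = \<epsilon> * (cmod u)\<^sup>2 - 2 * cmod u * cmod v + (cmod v)\<^sup>2 / \<epsilon>"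
      using assms by (simp add: power2_eq_square field_simps)
    finally have "2 * cmod u * cmod v \<le> \<epsilon> * (cmod u)\<^sup>2 + (cmod v)\<^sup>2 / \<epsilon>" by simp
    moreover have "(cmod (u - v))\<^sup>2 \<le> (cmod u + cmod v)\<^sup>2"
      by (intro power_mono norm_triangle_ineq4) simp
    ultimately show ?thesis by (simp add: power2_sum distrib_right)
  qed
  have "sampled_energy (restr f (core n)) \<le> (\<integral>\<^sup>+ l. ennreal (1 + \<epsilon>) * ennreal (weight_a \<Lambda> l * (cmod (synth (restr f UNIV) l))\<^sup>2)
      + ennreal (1 + 1 / \<epsilon>) * ennreal (weight_a \<Lambda> l * (cmod (synth (restr f (- core n)) l))\<^sup>2) \<partial>count_space \<Lambda>)"
    unfolding sampled_energy_def
  proof (rule nn_integral_mono)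
    fix l
    let ?a = "weight_a \<Lambda> l" and ?u = "synth (restr f UNIV) l" and ?v = "synth (restr f (- core n)) l"
    have "?a * (cmod (synth (restr f (core n)) l))\<^sup>2 \<le> (1 + \<epsilon>) * (?a * (cmod ?u)\<^sup>2) + (1 + 1 / \<epsilon>) * (?a * (cmod ?v)\<^sup>2)"
      using mult_left_mono[OF young[of ?u ?v] weight_a_nonneg[of l]]
      by (simp add: synth_restr_core synth_restr_UNIV algebra_simps)
    from ennreal_leI[OF this]
    show "ennreal (?a * (cmod (synth (restr f (core n)) l))\<^sup>2)
        \<le> ennreal (1 + \<epsilon>) * ennreal (?a * (cmod ?u)\<^sup>2) + ennreal (1 + 1 / \<epsilon>) * ennreal (?a * (cmod ?v)\<^sup>2)"
      using assms weight_a_nonneg[of l] by (simp add: ennreal_mult[symmetric] ennreal_plus[symmetric] del: ennreal_plus)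
  qed
  also have "\<dots> = ennreal (1 + \<epsilon>) * sampled_energy (restr f UNIV)
     + ennreal (1 + 1 / \<epsilon>) * sampled_energy (restr f (- core n))"
    unfolding sampled_energy_def by (simp add: nn_integral_add nn_integral_cmult)
  finally show ?thesis .
qed

text \<open>Fatou in x bounds the norm by the projected truncations, the sampling inequality moves
  to their sampled energies, and the triangle estimate replaces these by the sampled energy of f
  plus a tail term.\<close>

lemma norm_square_le_sampled_energy:
  assumes "\<epsilon> > 0" and small: "ennreal D * Omega \<psi> < \<infinity>"
  shows "ennreal ((norm f)\<^sup>2) \<le> ennreal (1 + \<epsilon>) * sampled_energy (restr f UNIV) + ennreal D * Omega \<psi> * ennreal ((norm f)\<^sup>2)"
proof -
  define c where "c = ennreal (1 + 1 / \<epsilon>) * (1 + ennreal D * Omega \<psi>)"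
  define A where "A = ennreal (1 + \<epsilon>) * sampled_energy (restr f UNIV) + ennreal D * Omega \<psi> * ennreal ((norm f)\<^sup>2)"
  have c: "c < \<infinity>" unfolding c_def using small by (simp add: ennreal_mult_less_top)
  have lim: "liminf (\<lambda>n. ennreal ((cmod (synth (restr f (core n)) x))\<^sup>2)) = ennreal ((cmod (hinner f (\<psi> x)))\<^sup>2)" for x
    using synth_restr_tendsto[of UNIV f x]
    by (intro lim_imp_Liminf tendsto_ennrealI tendsto_power tendsto_norm) (simp_all add: synth_restr_UNIV)
  have "ennreal ((norm f)\<^sup>2) = (\<integral>\<^sup>+ x. liminf (\<lambda>n. ennreal ((cmod (synth (restr f (core n)) x))\<^sup>2)) \<partial>lborel)"
    unfolding lim by (rule parseval_nn[symmetric])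
  also have "\<dots> \<le> liminf (\<lambda>n. \<integral>\<^sup>+ x. ennreal ((cmod (synth (restr f (core n)) x))\<^sup>2) \<partial>lborel)"
    by (rule nn_integral_liminf) measurable
  also have "\<dots> \<le> liminf (\<lambda>n. A + c * energy f (- core n))"
  proof (rule Liminf_mono, rule always_eventually, rule allI)
    fix n
    have N: "nice (restr f (core n))" using nice_restr[of UNIV f n] by simp
    have "(\<integral>\<^sup>+ x. ennreal ((cmod (synth (restr f (core n)) x))\<^sup>2) \<partial>lborel)
        \<le> sampled_energy (restr f (core n)) + ennreal D * Omega \<psi> * energy f (core n)"
      unfolding sampled_energy_def energy_def by (rule sampling_inequalities(2)[OF N])
    also have "\<dots> \<le> (ennreal (1 + \<epsilon>) * sampled_energy (restr f UNIV)
        + ennreal (1 + 1 / \<epsilon>) * ((1 + ennreal D * Omega \<psi>) * energy f (- core n))) + ennreal D * Omega \<psi> * energy f UNIV"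
      by (intro add_mono order_trans[OF sampled_energy_triangle[OF assms(1)]] mult_left_mono
          sampled_energy_restr_le energy_mono) auto
    also have "\<dots> = A + c * energy f (- core n)"
      by (simp add: A_def c_def energy_UNIV ac_simps)
    finally show "(\<integral>\<^sup>+ x. ennreal ((cmod (synth (restr f (core n)) x))\<^sup>2) \<partial>lborel) \<le> A + c * energy f (- core n)" .
  qed
  \<comment> \<open>Finiteness of c ensures that c times the tail energy still tends to 0.\<close>
  also have "liminf (\<lambda>n. A + c * energy f (- core n)) = A + c * 0"
    using c by (intro lim_imp_Liminf tendsto_add tendsto_const ennreal_tendsto_cmult energy_tail_tendsto) simp_all
  finally show ?thesis by (simp add: A_def)
qed

lemma sampled_frame_bounds:
  assumes small: "ennreal D * Omega \<psi> < 1"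
  shows "is_frame \<Lambda> (\<lambda>l. sqrt (weight_a \<Lambda> l) *\<^sub>R \<psi> l)
           (1 - D * enn2real (Omega \<psi>)) (1 + D * enn2real (Omega \<psi>))"
  unfolding is_frame_def
proof
  fix f :: 'a
  define e where "e = D * enn2real (Omega \<psi>)"
  \<comment> \<open>Otherwise the product with the positive D would be infinite.\<close>
  have "Omega \<psi> \<noteq> top"
    using small discrepancy_pos by (auto simp: ennreal_mult_top)
  then have e: "ennreal D * Omega \<psi> = ennreal e" and e0: "0 \<le> e"
    using discrepancy_pos unfolding e_def by (simp_all add: ennreal_mult' less_top)
  have fin: "ennreal D * Omega \<psi> < \<infinity>" unfolding e by simp
  define g where "g l = weight_a \<Lambda> l * (cmod (hinner f (\<psi> l)))\<^sup>2" for l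
  have g0: "0 \<le> g l" for l unfolding g_def by (simp add: weight_a_nonneg)
  have g: "(cmod (hinner f (sqrt (weight_a \<Lambda> l) *\<^sub>R \<psi> l)))\<^sup>2 = g l" for l
    unfolding g_def hinner_scaleR_right by (simp add: norm_mult power_mult_distrib weight_a_nonneg)
  have S: "sampled_energy (restr f UNIV) = (\<integral>\<^sup>+ l. ennreal (g l) \<partial>count_space \<Lambda>)"
    unfolding sampled_energy_def synth_restr_UNIV g_def ..
  have up: "(\<integral>\<^sup>+ l. ennreal (g l) \<partial>count_space \<Lambda>) \<le> ennreal ((1 + e) * (norm f)\<^sup>2)"
    using sampled_energy_restr_le[of UNIV f] e0
    unfolding S e energy_UNIV by (simp add: ennreal_mult)
  then have "(\<integral>\<^sup>+ l. ennreal (g l) \<partial>count_space \<Lambda>) < \<infinity>"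
    using le_less_trans by fastforce
  note sum = nn_integral_count_space_infsum[OF g0 this]
  have s0: "0 \<le> infsum g \<Lambda>" using g0 by (intro infsum_nonneg)
  have "(norm f)\<^sup>2 - e * (norm f)\<^sup>2 \<le> infsum g \<Lambda> + \<delta>" if "\<delta> > 0" for \<delta>
  proof -
    \<comment> \<open>This makes \<epsilon> times the sampled sum at most \<delta>; adding 1 keeps
      the denominator positive when the sum is 0. Letting \<delta> tend to 0 removes the loss from
      Young's inequality.\<close>
    define \<epsilon> where "\<epsilon> = \<delta> / (infsum g \<Lambda> + 1)"
    have \<epsilon>: "\<epsilon> > 0" unfolding \<epsilon>_def using that s0 by simp
    have "ennreal ((norm f)\<^sup>2) \<le> ennreal ((1 + \<epsilon>) * infsum g \<Lambda> + e * (norm f)\<^sup>2)"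
      using norm_square_le_sampled_energy[OF \<epsilon> fin, of f] \<epsilon> s0 e0
      unfolding S sum(2)[symmetric] e by (simp add: ennreal_mult)
    then have "(norm f)\<^sup>2 \<le> (1 + \<epsilon>) * infsum g \<Lambda> + e * (norm f)\<^sup>2"
      using \<epsilon> s0 e0 by (subst (asm) ennreal_le_iff) auto
    moreover have "\<epsilon> * infsum g \<Lambda> \<le> \<delta>"
      unfolding \<epsilon>_def using that s0 by (simp add: field_simps)
    ultimately show ?thesis by (simp add: distrib_right)
  qed
  then have "(norm f)\<^sup>2 - e * (norm f)\<^sup>2 \<le> infsum g \<Lambda>"
    by (rule field_le_epsilon)
  moreover have "infsum g \<Lambda> \<le> (1 + e) * (norm f)\<^sup>2"
    using up e0 unfolding sum(2)[symmetric] by (subst (asm) ennreal_le_iff) auto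
  ultimately show "(\<lambda>l. (cmod (hinner f (sqrt (weight_a \<Lambda> l) *\<^sub>R \<psi> l)))\<^sup>2) summable_on \<Lambda> \<and>
     (1 - D * enn2real (Omega \<psi>)) * (norm f)\<^sup>2 \<le> (\<Sum>\<^sub>\<infinity>l\<in>\<Lambda>. (cmod (hinner f (sqrt (weight_a \<Lambda> l) *\<^sub>R \<psi> l)))\<^sup>2) \<and>
     (\<Sum>\<^sub>\<infinity>l\<in>\<Lambda>. (cmod (hinner f (sqrt (weight_a \<Lambda> l) *\<^sub>R \<psi> l)))\<^sup>2) \<le> (1 + D * enn2real (Omega \<psi>)) * (norm f)\<^sup>2"
    unfolding g e_def[symmetric] using sum(1) by (simp add: left_diff_distrib)
qed

end

theorem theorem2:
  fixes \<psi> :: "real \<times> real \<Rightarrow> 'a::complex_hilbert"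
    and \<Lambda> :: "(real \<times> real) set"
  assumes "separable_space TYPE('a)"
    and "continuous_parseval_frame \<psi>"
    and "AE p in (lborel :: ((real \<times> real) \<times> (real \<times> real)) measure).
           has_cont_mixed_partials (frame_K \<psi> (fst p) (snd p))"
    and "\<forall>B. bounded B \<longrightarrow> finite (\<Lambda> \<inter> B)"
    and "\<forall>\<rho>. count_N \<Lambda> \<rho> \<ge> 1"
    and "ennreal (shift_discrepancy \<Lambda>) * Omega \<psi> < 1"
  shows "is_frame \<Lambda> (\<lambda>l. sqrt (weight_a \<Lambda> l) *\<^sub>R \<psi> l)
           (1 - shift_discrepancy \<Lambda> * enn2real (Omega \<psi>))
           (1 + shift_discrepancy \<Lambda> * enn2real (Omega \<psi>))"
proof -
  interpret sampled_frame \<psi> \<Lambda>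
    by unfold_locales (use assms in auto)
  show ?thesis by (rule sampled_frame_bounds) fact
qed

end
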